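(* Let $p$ be an odd prime, let $\zeta = e^{2\pi\sqrt{-1}/p}$, $K = \mathbb{Q}(\zeta)$, and let $h$ be the class number of the ring of integers $\mathcal{O}_K$ of $K$. Suppose that $p \nmid h$. Then there are no integers $x_0, y_0, z_0$ with $p \nmid x_0 y_0 z_0$ such that $x_0^p + y_0^p = z_0^p$.
   Context: The class number of $\mathcal{O}_K$ is the order of its ideal class group. *)

theory Defs
  imports
    Complex_Main
    "HOL-Algebra.Coset"
    "HOL-Algebra.Ideal_Product"
    "HOL-Algebra.Generated_Fields"
    "HOL-Algebra.Algebraic_Closure_Type"
    "HOL-Computational_Algebra.Primes"
begin

section \<open>The ideal class group of a domain \<open>R\<close> inside its field of fractions \<open>K\<close>\<close>

definition fractional_ideal :: "('a, 'b) ring_scheme \<Rightarrow> 'a set \<Rightarrow> 'a set \<Rightarrow> bool" where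
  "fractional_ideal K R I \<longleftrightarrow>
     subgroup I (add_monoid K) \<and>
     (\<forall>r\<in>R. \<forall>x\<in>I. r \<otimes>\<^bsub>K\<^esub> x \<in> I) \<and>
     I \<noteq> {\<zero>\<^bsub>K\<^esub>} \<and>
     (\<exists>d\<in>R - {\<zero>\<^bsub>K\<^esub>}. \<forall>x\<in>I. d \<otimes>\<^bsub>K\<^esub> x \<in> R)"

text \<open>
  \<^const>\<open>ideal_prod\<close> generates the set of finite sums of products; it does not require its
  arguments to be integral ideals, so it also gives the product of fractional ideals.
\<close>

definition fractional_ideals :: "('a, 'b) ring_scheme \<Rightarrow> 'a set \<Rightarrow> 'a set monoid" where
  "fractional_ideals K R =
     \<lparr>carrier = {I. fractional_ideal K R I}, monoid.mult = ideal_prod K, one = R\<rparr>"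

definition principal_fractional_ideals :: "('a, 'b) ring_scheme \<Rightarrow> 'a set \<Rightarrow> 'a set set" where
  "principal_fractional_ideals K R = {a <#\<^bsub>K\<^esub> R | a. a \<in> carrier K - {\<zero>\<^bsub>K\<^esub>}}"

definition ideal_class_group :: "('a, 'b) ring_scheme \<Rightarrow> 'a set \<Rightarrow> 'a set set monoid" where
  "ideal_class_group K R = fractional_ideals K R Mod principal_fractional_ideals K R"

definition class_number :: "('a, 'b) ring_scheme \<Rightarrow> 'a set \<Rightarrow> nat" where
  "class_number K R = Coset.order (ideal_class_group K R)"


section \<open>Subfields of the complex numbers\<close>

definition rat_adjoin :: "complex \<Rightarrow> complex ring" where
  "rat_adjoin z =
     ring_of_type_algebra\<lparr>carrier := generate_field ring_of_type_algebra (insert z \<rat>)\<rparr>"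

definition ring_of_integers :: "complex ring \<Rightarrow> complex set" where
  "ring_of_integers K = {x \<in> carrier K. algebraic_int x}"

end

(*
The factorization x^p + y^p = prod_k (x + zeta^k y) = z^p makes a = x + zeta y coprime to the product b
of the other factors. Hence the ideal I = (a, z) satisfies I^p = (a), and since p does not divide h,
I = (g) and a = u g^p with a unit u. By Kronecker's argument u = zeta^k u' for the complex conjugate u'
of u, and g^p is congruent to a rational integer modulo p, so a and zeta^k a' are congruent modulo p.
Comparing coefficients of powers of zeta for p >= 5 gives x = y mod p; by symmetry also x = -z mod p,
so p divides 3 x^p. For p = 3 reduce modulo 9.

Unique factorization of ideals is not used. That fractional ideals are invertible follows from h <> 0
(an infinite class group has order 0 here, which p divides): among the powers of an ideal M two are
equivalent, and an equation B M = M with M finitely generated forces B = O_K.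
*)

theory Submission
  imports Defs
begin

section \<open>Algebraic integers and finitely generated subgroups\<close>

text \<open>One fact carries the arithmetic of Q(\<zeta>): as p and (1 - \<zeta>)^(p-1) divide each
  other, an integer polynomial of degree below p - 1 whose value at \<zeta> is divisible by p has
  all its coefficients divisible by p. It gives the independence of 1, ..., \<zeta>^(p-2), hence
  well-defined conjugates (values of the same polynomial at the other roots of unity), then with a
  trace formula O_K = Z[\<zeta>], and at the end the comparison of coefficients. O_K = Z[\<zeta>]
  supplies the integer coordinates for Kronecker's argument and for reducing g^p modulo p. In
  Kronecker's step u / cnj u is first only some root of unity; its congruence to 1 modulo 1 -
  \<zeta> forces its order to divide p and so excludes a minus sign. The bound p >= 5 comes from the
  four terms of x + \<zeta> y - \<zeta>^k x - \<zeta>^(k-1) y. Because 1 + ... + \<zeta>^(p-1) = 0,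
  divisibility by p only makes all p coefficients congruent to each other; a fifth exponent, with
  coefficient 0, makes them all divisible by p.\<close>

definition ieval :: "int poly \<Rightarrow> complex \<Rightarrow> complex" where
  "ieval f x = poly (map_poly of_int f) x"

lemma ieval_0 [simp]: "ieval 0 x = 0"
  and ieval_1 [simp]: "ieval 1 x = 1"
  and ieval_pCons [simp]: "ieval (pCons a f) x = of_int a + x * ieval f x"
  by (simp_all add: ieval_def map_poly_pCons)

lemma ieval_add [simp]: "ieval (f + g) x = ieval f x + ieval g x"
  by (induction f g rule: poly_induct2) (simp_all add: algebra_simps)

lemma ieval_smult [simp]: "ieval (Polynomial.smult c f) x = of_int c * ieval f x"
  by (induction f) (simp_all add: algebra_simps)

lemma ieval_uminus [simp]: "ieval (- f) x = - ieval f x"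
  using ieval_smult[of "-1" f x] by simp

lemma ieval_diff [simp]: "ieval (f - g) x = ieval f x - ieval g x"
  using ieval_add[of f "- g" x] by simp

lemma ieval_mult [simp]: "ieval (f * g) x = ieval f x * ieval g x"
  by (induction f) (simp_all add: algebra_simps)

lemma ieval_power [simp]: "ieval (f ^ n) x = ieval f x ^ n"
  by (induction n) simp_all

lemma ieval_sum [simp]: "ieval (sum f I) x = (\<Sum>i\<in>I. ieval (f i) x)"
  by (induction I rule: infinite_finite_induct) simp_all

lemma ieval_monom [simp]: "ieval (Polynomial.monom c n) x = of_int c * x ^ n"
  by (simp add: ieval_def map_poly_monom poly_monom)

lemma ieval_pcompose [simp]: "ieval (pcompose f g) x = ieval f (ieval g x)"
  by (induction f) (simp_all add: pcompose_pCons algebra_simps)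

lemma ieval_altdef:
  assumes "Polynomial.degree f < n"
  shows "ieval f x = (\<Sum>i<n. of_int (Polynomial.coeff f i) * x ^ i)"
proof -
  have "ieval f x = (\<Sum>i\<le>Polynomial.degree f. of_int (Polynomial.coeff f i) * x ^ i)"
    by (simp add: ieval_def poly_altdef coeff_map_poly degree_map_poly)
  also have "\<dots> = (\<Sum>i<n. of_int (Polynomial.coeff f i) * x ^ i)"
    using assms by (intro sum.mono_neutral_left) (auto intro!: coeff_eq_0)
  finally show ?thesis .
qed

lemma cnj_ieval: "cnj (ieval f x) = ieval f (cnj x)"
  by (induction f) simp_all

lemma algebraic_int_iff_ieval:
  "algebraic_int x \<longleftrightarrow> (\<exists>f. ieval f x = 0 \<and> lead_coeff f = 1)"
  by (simp add: algebraic_int_altdef_ipoly ieval_def)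

text \<open>A linear system \<open>s = \<Sum>\<^sub>t b\<^sub>s\<^sub>t t\<close> with a nonzero solution forces \<open>det (1 - b) = 0\<close>, and
  this determinant is \<open>1\<close> modulo the ideal containing the \<open>b\<^sub>s\<^sub>t\<close>. Eliminating one
  unknown at a time avoids the determinant.\<close>
lemma nakayama_field:
  fixes B :: "'a :: field set"
  assumes "finite S"
    and zero: "0 \<in> B"
    and diff: "\<And>x y. x \<in> B \<Longrightarrow> y \<in> B \<Longrightarrow> x - y \<in> B"
    and mult: "\<And>x y. x \<in> B \<Longrightarrow> y \<in> B \<Longrightarrow> x * y \<in> B"
    and "\<And>s t. s \<in> S \<Longrightarrow> t \<in> S \<Longrightarrow> b s t \<in> B"
    and "\<And>s. s \<in> S \<Longrightarrow> s = (\<Sum>t\<in>S. b s t * t)"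
  shows "1 \<in> B \<or> (\<forall>s\<in>S. s = 0)"
  using assms(1,5,6)
proof (induction S arbitrary: b rule: finite_induct)
  case empty
  then show ?case by simp
next
  case (insert u S)
  have add: "x + y \<in> B" if "x \<in> B" "y \<in> B" for x y
    using diff[OF that(1) diff[OF zero that(2)]] by simp
  \<comment> \<open>Multiply the equation for \<open>s\<close> by \<open>1 - b u u\<close>, replace
    \<open>(1 - b u u) * u\<close> by its expression in \<open>S\<close>, and add
    \<open>b u u * s\<close> to both sides. Nothing is divided, so the new coefficients stay in
    \<open>B\<close>.\<close>
  define b' where "b' s t = b s u * b u t + b s t - b u u * b s t + (if s = t then b u u else 0)" for s t
  have eq: "s = b s u * u + (\<Sum>t\<in>S. b s t * t)" if "s \<in> insert u S" for s
    using insert.prems(2)[OF that] insert.hyps by simp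
  have u: "(1 - b u u) * u = (\<Sum>t\<in>S. b u t * t)"
    using eq[of u] by (simp add: algebra_simps)
  have "1 \<in> B \<or> (\<forall>s\<in>S. s = 0)"
  proof (rule insert.IH[of b'])
    show "b' s t \<in> B" if "s \<in> S" "t \<in> S" for s t
      unfolding b'_def using that insert.prems(1)
      by (auto intro!: add diff mult zero)
    show "s = (\<Sum>t\<in>S. b' s t * t)" if s: "s \<in> S" for s
    proof -
      have "(\<Sum>t\<in>S. b' s t * t) = b s u * (\<Sum>t\<in>S. b u t * t) + (\<Sum>t\<in>S. b s t * t)
          - b u u * (\<Sum>t\<in>S. b s t * t) + (\<Sum>t\<in>S. if s = t then b u u * t else 0)"
        unfolding sum_distrib_left sum.distrib[symmetric] sum_subtractf[symmetric] b'_def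
        by (intro sum.cong) (auto simp: algebra_simps)
      also have "(\<Sum>t\<in>S. if s = t then b u u * t else 0) = b u u * s"
        using s insert.hyps by simp
      also have "b s u * (\<Sum>t\<in>S. b u t * t) = (1 - b u u) * (b s u * u)"
        unfolding u[symmetric] by (simp add: algebra_simps)
      also have "(1 - b u u) * (b s u * u) + (\<Sum>t\<in>S. b s t * t) - b u u * (\<Sum>t\<in>S. b s t * t) + b u u * s
        = (1 - b u u) * (b s u * u + (\<Sum>t\<in>S. b s t * t)) + b u u * s"
        by (simp add: algebra_simps)
      also have "\<dots> = s"
        using eq[of s] s by (simp add: algebra_simps)
      finally show ?thesis by simp
    qed
  qed
  then show ?case
  proof
    \<comment> \<open>Now \<open>(1 - b u u) * u = 0\<close>: either \<open>u = 0\<close> as well,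
      or \<open>1 = b u u\<close> lies in \<open>B\<close>.\<close>
    assume 0: "\<forall>s\<in>S. s = 0"
    then have "(1 - b u u) * u = 0" unfolding u by (intro sum.neutral) simp
    then show ?thesis using insert.prems(1)[of u u] 0 by auto
  qed auto
qed

text \<open>\<open>zmod.span S\<close> is the additive subgroup of the complex numbers generated by
  \<open>S\<close>.\<close>

interpretation zmod: Modules.module "\<lambda>(n::int) (x::complex). of_int n * x"
  by unfold_locales (simp_all add: algebra_simps)

lemma zspan_mult_closed:
  assumes "\<And>t. t \<in> T \<Longrightarrow> a * t \<in> zmod.span S" and "w \<in> zmod.span T"
  shows "a * w \<in> zmod.span S"
  using assms(2)
proof (induction rule: zmod.span_induct)
  case base
  have eq: "a * (of_int c * x) = of_int c * (a * x)" for c x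
    by simp
  show ?case
    unfolding zmod.subspace_def
    by (auto simp: distrib_left eq intro!: zmod.span_add zmod.span_scale zmod.span_zero)
qed (use assms in auto)

text \<open>Dividing the relations for \<open>a * s\<close> by \<open>a\<close> gives a system with
  coefficients in \<open>B\<close>, the multiples of \<open>1/a\<close> in Z[1/a]. So 1 is in
  \<open>B\<close>, that is, \<open>1/a\<close> is a root of a polynomial \<open>1 - X f(X)\<close>;
  reversing its coefficients gives a monic equation for \<open>a\<close>.\<close>

lemma algebraic_int_if_stable:
  fixes a :: complex
  assumes "finite S" "\<exists>s\<in>S. s \<noteq> 0" and stable: "\<And>s. s \<in> S \<Longrightarrow> a * s \<in> zmod.span S"
  shows "algebraic_int a"
proof (cases "a = 0")
  case False
  define B where "B = {inverse a * ieval f (inverse a) | f. True}"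
  have "\<exists>c. a * s = (\<Sum>t\<in>S. of_int (c t) * t)" if "s \<in> S" for s
    using stable[OF that] unfolding zmod.span_finite[OF \<open>finite S\<close>] by auto
  then obtain c where c: "\<And>s. s \<in> S \<Longrightarrow> a * s = (\<Sum>t\<in>S. of_int (c s t) * t)"
    by metis
  have "1 \<in> B \<or> (\<forall>s\<in>S. s = 0)"
  proof (rule nakayama_field[where b = "\<lambda>s t. inverse a * of_int (c s t)"])
    show "0 \<in> B" unfolding B_def by (auto intro: exI[of _ 0])
    show "x - y \<in> B" "x * y \<in> B" if xy: "x \<in> B" "y \<in> B" for x y
    proof -
      obtain f g where fg: "x = inverse a * ieval f (inverse a)" "y = inverse a * ieval g (inverse a)"
        using xy unfolding B_def by auto
      have "x - y = inverse a * ieval (f - g) (inverse a)"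
        "x * y = inverse a * ieval (pCons 0 (f * g)) (inverse a)"
        by (simp_all add: fg algebra_simps)
      then show "x - y \<in> B" "x * y \<in> B" unfolding B_def by blast+
    qed
    show "inverse a * of_int (c s t) \<in> B" for s t
      unfolding B_def by (auto intro!: exI[of _ "[:c s t:]"])
    show "s = (\<Sum>t\<in>S. inverse a * of_int (c s t) * t)" if "s \<in> S" for s
    proof -
      have "s = inverse a * (a * s)" using False by simp
      then show ?thesis unfolding c[OF that] by (simp add: sum_distrib_left mult.assoc)
    qed
  qed (use assms in auto)
  then obtain f where f: "1 = inverse a * ieval f (inverse a)"
    using assms(2) unfolding B_def by auto
  have "algebraic_int (inverse (inverse a))"
  proof (rule algebraic_int_inverse)
    have "ieval (pCons 1 (- f)) (inverse a) = 0"
      using f by simp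
    then show "poly (map_poly of_int (pCons 1 (- f))) (inverse a) = 0"
      unfolding ieval_def .
  qed (simp_all add: coeff_map_poly)
  then show ?thesis by simp
qed simp

lemma algebraic_int_power_in_span:
  assumes "algebraic_int x"
  obtains m where "m > 0" "x ^ m \<in> zmod.span ((\<lambda>i. x ^ i) ` {..<m})"
proof -
  obtain f where f: "ieval f x = 0" "lead_coeff f = 1"
    using assms unfolding algebraic_int_iff_ieval by auto
  define m where "m = Polynomial.degree f"
  have "m > 0"
  proof (rule ccontr)
    assume "\<not> m > 0"
    then obtain c where "f = [:c:]" by (auto simp: m_def elim: degree_eq_zeroE)
    then show False using f by simp
  qed
  moreover have "x ^ m = - (\<Sum>i<m. of_int (Polynomial.coeff f i) * x ^ i)"
    using f ieval_altdef[of f "Suc m" x] by (simp add: m_def add_eq_0_iff)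
  then have "x ^ m \<in> zmod.span ((\<lambda>i. x ^ i) ` {..<m})"
    by (auto intro!: zmod.span_neg zmod.span_sum zmod.span_scale intro: zmod.span_base)
  ultimately show thesis using that by blast
qed

text \<open>The products \<open>x^i y^j\<close> with \<open>i < m\<close> and \<open>j < n\<close>
  generate a subgroup stable under multiplication by \<open>x\<close> and by \<open>y\<close>, hence
  under \<open>x + y\<close> and \<open>x * y\<close>.\<close>

lemma
  assumes x: "algebraic_int x" and y: "algebraic_int y"
  shows algebraic_int_plus_complex: "algebraic_int (x + y :: complex)"
    and algebraic_int_times_complex: "algebraic_int (x * y)"
proof -
  obtain m where m: "m > 0" "x ^ m \<in> zmod.span ((\<lambda>i. x ^ i) ` {..<m})"
    using algebraic_int_power_in_span[OF x] .
  obtain n where n: "n > 0" "y ^ n \<in> zmod.span ((\<lambda>i. y ^ i) ` {..<n})"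
    using algebraic_int_power_in_span[OF y] .
  define S where "S = (\<lambda>(i,j). x ^ i * y ^ j) ` ({..<m} \<times> {..<n})"
  have inS: "x ^ i * y ^ j \<in> zmod.span S" if "i < m" "j < n" for i j
    using that by (auto simp: S_def intro!: zmod.span_base)
  have xs: "x * s \<in> zmod.span S" if s: "s \<in> S" for s
  proof -
    obtain i j where ij: "i < m" "j < n" "s = x ^ i * y ^ j"
      using s by (auto simp: S_def)
    show ?thesis
    proof (cases "Suc i = m")
      case True
      have "y ^ j * x ^ m \<in> zmod.span S"
        by (rule zspan_mult_closed[OF _ m(2)]) (use ij inS in \<open>auto simp: mult.commute\<close>)
      moreover have "x * s = y ^ j * x ^ m"
        unfolding ij(3) True[symmetric] by simp
      ultimately show ?thesis by simp
    next
      case False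
      then show ?thesis using inS[of "Suc i" j] ij by (simp add: algebra_simps)
    qed
  qed
  have ys: "y * s \<in> zmod.span S" if s: "s \<in> S" for s
  proof -
    obtain i j where ij: "i < m" "j < n" "s = x ^ i * y ^ j"
      using s by (auto simp: S_def)
    show ?thesis
    proof (cases "Suc j = n")
      case True
      have "x ^ i * y ^ n \<in> zmod.span S"
        by (rule zspan_mult_closed[OF _ n(2)]) (use ij inS in auto)
      moreover have "y * s = x ^ i * y ^ n"
        unfolding ij(3) True[symmetric] by simp
      ultimately show ?thesis by simp
    next
      case False
      then show ?thesis using inS[of i "Suc j"] ij by (simp add: algebra_simps)
    qed
  qed
  have fin: "finite S" and one: "\<exists>s\<in>S. s \<noteq> 0"
    using m n by (auto simp: S_def intro!: bexI[of _ "(0,0)"])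
  show "algebraic_int (x + y)"
    by (rule algebraic_int_if_stable[OF fin one])
       (auto simp: distrib_right intro!: zmod.span_add xs ys)
  show "algebraic_int (x * y)"
    by (rule algebraic_int_if_stable[OF fin one])
       (auto simp: mult.assoc intro!: zspan_mult_closed[OF xs] ys)
qed

lemma algebraic_int_diff_complex:
  "algebraic_int x \<Longrightarrow> algebraic_int y \<Longrightarrow> algebraic_int (x - y :: complex)"
  using algebraic_int_plus_complex[of x "- y"] by simp

lemma algebraic_int_power_complex: "algebraic_int x \<Longrightarrow> algebraic_int (x ^ n :: complex)"
  by (induction n) (simp_all add: algebraic_int_times_complex)

lemma algebraic_int_sum_complex:
  "(\<And>i. i \<in> I \<Longrightarrow> algebraic_int (f i)) \<Longrightarrow> algebraic_int (sum f I :: complex)"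
  by (induction I rule: infinite_finite_induct) (simp_all add: algebraic_int_plus_complex)

lemma algebraic_int_prod_complex:
  "(\<And>i. i \<in> I \<Longrightarrow> algebraic_int (f i)) \<Longrightarrow> algebraic_int (prod f I :: complex)"
  by (induction I rule: infinite_finite_induct) (simp_all add: algebraic_int_times_complex)

lemma algebraic_int_ieval:
  assumes "algebraic_int x"
  shows "algebraic_int (ieval f x)"
proof (induction f)
  case (pCons a f)
  show ?case
    unfolding ieval_pCons
    by (intro algebraic_int_plus_complex algebraic_int_times_complex assms pCons.IH algebraic_int_of_int)
qed simp

lemmas algebraic_int_closed =
  algebraic_int_plus_complex algebraic_int_diff_complex algebraic_int_times_complex
  algebraic_int_power_complex algebraic_int_sum_complex algebraic_int_prod_complex
  algebraic_int_ieval

text \<open>The coefficients of \<open>v\<close> that occur in \<open>M\<close>, modulo the span of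
  \<open>S\<close>, form a subgroup \<open>C\<close> of the integers. An element \<open>m0\<close>
  of \<open>M\<close> realizing the generator \<open>d\<close> of \<open>C\<close>, together with
  generators of the part of \<open>M\<close> inside the span of \<open>S\<close>, generates
  \<open>M\<close>.\<close>

lemma zsubspace_finitely_generated:
  assumes "finite S" "zmod.subspace M" "M \<subseteq> zmod.span S"
  shows "\<exists>T. finite T \<and> M = zmod.span T"
  using assms
proof (induction S arbitrary: M rule: finite_induct)
  case empty
  then have "M = zmod.span {}" using zmod.subspace_0[of M] by auto
  then show ?case by blast
next
  case (insert v S)
  define M' where "M' = M \<inter> zmod.span S"
  have "zmod.subspace M'"
    unfolding M'_def by (intro zmod.subspace_inter insert.prems zmod.subspace_span)
  then obtain T where T: "finite T" "M' = zmod.span T"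
    using insert.IH[of M'] by (auto simp: M'_def)
  define C where "C = {c::int. \<exists>m\<in>M. m - of_int c * v \<in> zmod.span S}"
  show ?case
  proof (cases "\<exists>c\<in>C. c \<noteq> 0")
    case False
    have "M \<subseteq> zmod.span S"
    proof
      fix m assume m: "m \<in> M"
      then obtain c where c: "m - of_int c * v \<in> zmod.span S"
        using insert.prems unfolding zmod.span_insert by blast
      then have "c = 0" using False m unfolding C_def by blast
      then show "m \<in> zmod.span S" using c by simp
    qed
    then have "M = zmod.span T" using T(2) unfolding M'_def by blast
    then show ?thesis using T(1) by blast
  next
    case True
    have Cdiff: "c - k * d \<in> C" if "c \<in> C" "d \<in> C" for c d k
    proof -
      obtain m n where mn: "m \<in> M" "n \<in> M"
        "m - of_int c * v \<in> zmod.span S" "n - of_int d * v \<in> zmod.span S"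
        using \<open>c \<in> C\<close> \<open>d \<in> C\<close> unfolding C_def by blast
      have "(m - of_int k * n) - of_int (c - k * d) * v \<in> zmod.span S"
        using zmod.span_diff[OF mn(3) zmod.span_scale[OF mn(4)], of k] by (simp add: algebra_simps)
      moreover have "m - of_int k * n \<in> M"
        by (intro zmod.subspace_diff zmod.subspace_scale insert.prems mn)
      ultimately show ?thesis unfolding C_def by blast
    qed
    obtain c0 where c0: "c0 \<in> C" "c0 \<noteq> 0" using True by blast
    have "- c0 \<in> C" using Cdiff[OF c0(1) c0(1), of 2] by simp
    then have ex: "\<exists>n. n > 0 \<and> int n \<in> C"
      using c0 by (intro exI[of _ "nat \<bar>c0\<bar>"]) (auto simp: abs_if)
    define d where "d = (LEAST n. n > 0 \<and> int n \<in> C)"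
    have d: "d > 0" "int d \<in> C" and least: "\<And>n. n > 0 \<Longrightarrow> int n \<in> C \<Longrightarrow> d \<le> n"
      using LeastI_ex[OF ex] Least_le[of "\<lambda>n. n > 0 \<and> int n \<in> C"] unfolding d_def by blast+
    obtain m0 where m0: "m0 \<in> M" "m0 - of_int (int d) * v \<in> zmod.span S"
      using d(2) unfolding C_def by blast
    have dvd: "int d dvd c" if "c \<in> C" for c
    proof (rule ccontr)
      assume nd: "\<not> int d dvd c"
      have "c mod int d \<in> C"
        using Cdiff[OF that d(2), of "c div int d"] by (simp add: minus_div_mult_eq_mod)
      moreover have "c mod int d > 0" "c mod int d < int d"
        using nd d(1) pos_mod_bound[of "int d" c] pos_mod_sign[of "int d" c]
        unfolding dvd_eq_mod_eq_0 by linarith+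
      ultimately show False using least[of "nat (c mod int d)"] by simp
    qed
    have "M \<subseteq> zmod.span (insert m0 T)"
    proof
      fix m assume m: "m \<in> M"
      then obtain c where c: "m - of_int c * v \<in> zmod.span S"
        using insert.prems unfolding zmod.span_insert by blast
      then have "c \<in> C" using m unfolding C_def by blast
      then obtain k where k: "c = k * int d" using dvd by (auto simp: dvd_def mult.commute)
      have "m - of_int k * m0 \<in> zmod.span S"
        using zmod.span_diff[OF c zmod.span_scale[OF m0(2)], of k] by (simp add: k algebra_simps)
      moreover have "m - of_int k * m0 \<in> M"
        by (intro zmod.subspace_diff zmod.subspace_scale insert.prems m m0)
      ultimately show "m \<in> zmod.span (insert m0 T)"
        unfolding zmod.span_insert T(2)[symmetric] M'_def by blast
    qed
    moreover have "zmod.span (insert m0 T) \<subseteq> M"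
    proof (rule zmod.span_minimal)
      have "T \<subseteq> M'" unfolding T(2) by (rule zmod.span_superset)
      then show "insert m0 T \<subseteq> M" using m0(1) unfolding M'_def by blast
    qed (rule insert.prems(1))
    ultimately have "M = zmod.span (insert m0 T)" by blast
    then show ?thesis using T(1) by blast
  qed
qed

section \<open>Class groups of rings of algebraic integers\<close>

text \<open>Two properties of the ring of integers drive this part: denominators exist, which makes
  nonzero principal modules fractional ideals, and \<open>R\<close> lies in a finitely generated
  group, which makes all fractional ideals finitely generated.\<close>

locale number_ring =
  fixes F T :: "complex set" and K :: "complex ring" and R :: "complex set"
  assumes K_eq: "K = ring_of_type_algebra\<lparr>carrier := F\<rparr>"
    and R_eq: "R = ring_of_integers K"
    and one_F: "1 \<in> F"
    and diff_F: "x \<in> F \<Longrightarrow> y \<in> F \<Longrightarrow> x - y \<in> F"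
    and mult_F: "x \<in> F \<Longrightarrow> y \<in> F \<Longrightarrow> x * y \<in> F"
    and inverse_F: "x \<in> F \<Longrightarrow> inverse x \<in> F"
    and denominator_F: "x \<in> F \<Longrightarrow> \<exists>d\<in>R. d \<noteq> 0 \<and> d * x \<in> R"
    and finite_T: "finite T"
    and R_subset_span: "R \<subseteq> zmod.span T"
begin

lemma K_simps [simp]:
  "carrier K = F" "x \<otimes>\<^bsub>K\<^esub> y = x * y" "x \<oplus>\<^bsub>K\<^esub> y = x + y" "\<zero>\<^bsub>K\<^esub> = 0" "\<one>\<^bsub>K\<^esub> = 1"
  by (simp_all add: K_eq ring_of_type_algebra_def)

lemma zero_F: "0 \<in> F"
  using diff_F[OF one_F one_F] by simp

lemma uminus_F: "x \<in> F \<Longrightarrow> - x \<in> F"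
  using diff_F[OF zero_F] by fastforce

lemma add_F: "x \<in> F \<Longrightarrow> y \<in> F \<Longrightarrow> x + y \<in> F"
  using diff_F[of x "- y"] uminus_F by simp

lemma of_int_F: "of_int k \<in> F"
proof -
  have nat: "of_nat n \<in> F" for n
    by (induction n) (simp_all add: zero_F one_F add_F)
  show ?thesis
  proof (cases k)
    case (neg n)
    show ?thesis unfolding neg of_int_minus of_int_of_nat_eq by (intro uminus_F nat)
  qed (simp add: nat)
qed

lemma mem_R: "x \<in> R \<longleftrightarrow> x \<in> F \<and> algebraic_int x"
  by (simp add: R_eq ring_of_integers_def)

lemma R_closed:
  "0 \<in> R" "1 \<in> R" "of_int k \<in> R"
  "x \<in> R \<Longrightarrow> y \<in> R \<Longrightarrow> x + y \<in> R"
  "x \<in> R \<Longrightarrow> y \<in> R \<Longrightarrow> x - y \<in> R"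
  "x \<in> R \<Longrightarrow> y \<in> R \<Longrightarrow> x * y \<in> R"
  by (simp_all add: mem_R zero_F one_F of_int_F add_F diff_F mult_F algebraic_int_closed)

lemma power_R: "x \<in> R \<Longrightarrow> x ^ n \<in> R"
  by (induction n) (simp_all add: R_closed)

lemma a_inv_K: "x \<in> F \<Longrightarrow> inv\<^bsub>add_monoid K\<^esub> x = - x"
  unfolding m_inv_def
  by (rule the_equality) (simp_all add: uminus_F eq_neg_iff_add_eq_0 add.commute)

section \<open>Fractional ideals and their products\<close>

definition is_frac :: "complex set \<Rightarrow> bool" where
  "is_frac I \<longleftrightarrow> I \<subseteq> F \<and> 0 \<in> I \<and> (\<forall>x\<in>I. \<forall>y\<in>I. x + y \<in> I) \<and> (\<forall>r\<in>R. \<forall>x\<in>I. r * x \<in> I) \<and>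
     (\<exists>x\<in>I. x \<noteq> 0) \<and> (\<exists>d\<in>R. d \<noteq> 0 \<and> (\<forall>x\<in>I. d * x \<in> R))"

lemma fractional_ideal_iff: "fractional_ideal K R I \<longleftrightarrow> is_frac I"
proof
  assume I: "fractional_ideal K R I"
  then have sub: "subgroup I (add_monoid K)" unfolding fractional_ideal_def by blast
  have "I \<subseteq> F" using subgroup.subset[OF sub] by simp
  moreover have 0: "0 \<in> I" using subgroup.one_closed[OF sub] by simp
  moreover have "x + y \<in> I" if "x \<in> I" "y \<in> I" for x y
    using subgroup.m_closed[OF sub that] by simp
  ultimately show "is_frac I"
    using I 0 unfolding is_frac_def fractional_ideal_def by auto
next
  assume I: "is_frac I"
  \<comment> \<open>\<open>is_frac\<close> does not ask for negatives: they come from scaling by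
    -1.\<close>
  have "- 1 \<in> R" using R_closed(3)[of "-1"] by simp
  then have "- 1 * x \<in> I" if "x \<in> I" for x
    using I that unfolding is_frac_def by blast
  moreover have "I \<subseteq> F" using I unfolding is_frac_def by blast
  ultimately have "inv\<^bsub>add_monoid K\<^esub> x \<in> I" if "x \<in> I" for x
    using a_inv_K[of x] that by auto
  then have "subgroup I (add_monoid K)"
    using I unfolding is_frac_def by (intro subgroup.intro) simp_all
  then show "fractional_ideal K R I"
    using I unfolding is_frac_def fractional_ideal_def by auto
qed

lemma
  assumes "is_frac I"
  shows frac_subset: "I \<subseteq> F"
    and frac_zero: "0 \<in> I"
    and frac_add: "x \<in> I \<Longrightarrow> y \<in> I \<Longrightarrow> x + y \<in> I"
    and frac_scale: "r \<in> R \<Longrightarrow> x \<in> I \<Longrightarrow> r * x \<in> I"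
    and frac_nonzero: "\<exists>x\<in>I. x \<noteq> 0"
    and frac_denominator: "\<exists>d\<in>R. d \<noteq> 0 \<and> (\<forall>x\<in>I. d * x \<in> R)"
  using assms unfolding is_frac_def by blast+

lemma frac_scale_int: "is_frac I \<Longrightarrow> x \<in> I \<Longrightarrow> of_int k * x \<in> I"
  using frac_scale R_closed(3) by blast

lemma frac_diff: "is_frac I \<Longrightarrow> x \<in> I \<Longrightarrow> y \<in> I \<Longrightarrow> x - y \<in> I"
  using frac_add[of I x "- y"] frac_scale_int[of I y "-1"] by simp

lemma zsubspace_frac: "is_frac I \<Longrightarrow> zmod.subspace I"
  by (rule zmod.subspaceI) (simp_all add: frac_zero frac_add frac_scale_int)

abbreviation iprod (infixl "\<odot>" 75) where
  "I \<odot> J \<equiv> ideal_prod K I J"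

lemma iprodI: "x \<in> I \<Longrightarrow> y \<in> J \<Longrightarrow> x * y \<in> I \<odot> J"
  using ideal_prod.prod[of x I y J K] by simp

lemma iprod_add: "x \<in> I \<odot> J \<Longrightarrow> y \<in> I \<odot> J \<Longrightarrow> x + y \<in> I \<odot> J"
  using ideal_prod.sum[of x K I J y] by simp

lemma iprod_subsetI:
  assumes "\<And>i j. i \<in> I \<Longrightarrow> j \<in> J \<Longrightarrow> i * j \<in> S"
    and "\<And>x y. x \<in> S \<Longrightarrow> y \<in> S \<Longrightarrow> x + y \<in> S"
  shows "I \<odot> J \<subseteq> S"
proof
  fix x assume "x \<in> I \<odot> J"
  then show "x \<in> S"
    by (induction rule: ideal_prod.induct) (simp_all add: assms)
qed

lemma frac_iprod:
  assumes I: "is_frac I" and J: "is_frac J"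
  shows "is_frac (I \<odot> J)"
  unfolding is_frac_def
proof (intro conjI)
  show "I \<odot> J \<subseteq> F"
    using frac_subset[OF I] frac_subset[OF J] by (intro iprod_subsetI) (auto intro: mult_F add_F)
  show "0 \<in> I \<odot> J" using iprodI[OF frac_zero[OF I] frac_zero[OF J]] by simp
  show "\<forall>x\<in>I \<odot> J. \<forall>y\<in>I \<odot> J. x + y \<in> I \<odot> J" using iprod_add by blast
  show "\<forall>r\<in>R. \<forall>x\<in>I \<odot> J. r * x \<in> I \<odot> J"
  proof
    fix r assume r: "r \<in> R"
    have "I \<odot> J \<subseteq> {x. r * x \<in> I \<odot> J}"
    proof (rule iprod_subsetI)
      fix i j assume "i \<in> I" "j \<in> J"
      then show "i * j \<in> {x. r * x \<in> I \<odot> J}"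
        using iprodI[OF frac_scale[OF I r]] by (simp add: mult.assoc)
    qed (simp add: distrib_left iprod_add)
    then show "\<forall>x\<in>I \<odot> J. r * x \<in> I \<odot> J" by blast
  qed
  obtain x y where "x \<in> I" "x \<noteq> 0" "y \<in> J" "y \<noteq> 0"
    using frac_nonzero[OF I] frac_nonzero[OF J] by blast
  then show "\<exists>x\<in>I \<odot> J. x \<noteq> 0"
    using iprodI[of x I y J] by (intro bexI[of _ "x * y"]) simp_all
  obtain d e where d: "d \<in> R" "d \<noteq> 0" "\<And>x. x \<in> I \<Longrightarrow> d * x \<in> R"
    and e: "e \<in> R" "e \<noteq> 0" "\<And>x. x \<in> J \<Longrightarrow> e * x \<in> R"
    using frac_denominator[OF I] frac_denominator[OF J] by blast
  have "I \<odot> J \<subseteq> {x. d * e * x \<in> R}"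
  proof (rule iprod_subsetI)
    fix i j assume "i \<in> I" "j \<in> J"
    then have "(d * i) * (e * j) \<in> R" using d e R_closed by blast
    then show "i * j \<in> {x. d * e * x \<in> R}" by (simp add: mult_ac)
  qed (simp add: distrib_left R_closed)
  then show "\<exists>d\<in>R. d \<noteq> 0 \<and> (\<forall>x\<in>I \<odot> J. d * x \<in> R)"
    using d e R_closed(6) by (intro bexI[of _ "d * e"]) auto
qed

lemma iprod_commute: "I \<odot> J = J \<odot> I"
proof -
  have "I \<odot> J \<subseteq> J \<odot> I" for I J
    by (rule iprod_subsetI) (metis iprodI mult.commute, rule iprod_add)
  then show ?thesis by blast
qed

lemma iprod_assoc: "(I \<odot> J) \<odot> L = I \<odot> (J \<odot> L)"
proof -
  have sub: "(I \<odot> J) \<odot> L \<subseteq> I \<odot> (J \<odot> L)" for I J L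
  proof (rule iprod_subsetI)
    fix x l assume x: "x \<in> I \<odot> J" and l: "l \<in> L"
    have "I \<odot> J \<subseteq> {x. x * l \<in> I \<odot> (J \<odot> L)}"
    proof (rule iprod_subsetI)
      fix i j assume "i \<in> I" "j \<in> J"
      then show "i * j \<in> {x. x * l \<in> I \<odot> (J \<odot> L)}"
        using l by (simp add: mult.assoc iprodI)
    qed (simp add: distrib_right iprod_add)
    then show "x * l \<in> I \<odot> (J \<odot> L)" using x by blast
  qed (rule iprod_add)
  have "I \<odot> (J \<odot> L) = (L \<odot> J) \<odot> I"
    by (simp only: iprod_commute)
  also have "\<dots> \<subseteq> L \<odot> (J \<odot> I)" by (rule sub)
  also have "\<dots> = (I \<odot> J) \<odot> L"
    by (simp only: iprod_commute)
  finally show ?thesis using sub by blast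
qed

abbreviation principal :: "complex \<Rightarrow> complex set" where
  "principal a \<equiv> a <#\<^bsub>K\<^esub> R"

lemma principal_eq: "principal a = (\<lambda>r. a * r) ` R"
  by (auto simp: l_coset_def)

lemma principal_1: "principal 1 = R"
  by (simp add: principal_eq)

lemma frac_principal:
  assumes "a \<in> F" "a \<noteq> 0"
  shows "is_frac (principal a)"
  unfolding is_frac_def
proof (intro conjI)
  show "principal a \<subseteq> F" using assms by (auto simp: principal_eq mem_R mult_F)
  show "0 \<in> principal a" using R_closed(1) by (auto simp: principal_eq image_iff)
  show "\<forall>x\<in>principal a. \<forall>y\<in>principal a. x + y \<in> principal a"
  proof (intro ballI)
    fix x y assume "x \<in> principal a" "y \<in> principal a"
    then obtain r s where rs: "r \<in> R" "s \<in> R" "x = a * r" "y = a * s"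
      unfolding principal_eq by blast
    then have "x + y = a * (r + s)" by (simp add: distrib_left)
    then show "x + y \<in> principal a" unfolding principal_eq using rs R_closed(4) by blast
  qed
  show "\<forall>r\<in>R. \<forall>x\<in>principal a. r * x \<in> principal a"
  proof (intro ballI)
    fix r x assume r: "r \<in> R" and "x \<in> principal a"
    then obtain s where s: "s \<in> R" "x = a * s"
      unfolding principal_eq by blast
    then have "r * x = a * (r * s)" by (simp add: mult_ac)
    then show "r * x \<in> principal a" unfolding principal_eq using r s R_closed(6) by blast
  qed
  show "\<exists>x\<in>principal a. x \<noteq> 0"
    using assms R_closed(2) by (auto simp: principal_eq intro!: bexI[of _ 1])
  obtain d where d: "d \<in> R" "d \<noteq> 0" "d * a \<in> R" using denominator_F[OF assms(1)] by blast
  have "\<forall>x\<in>principal a. d * x \<in> R"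
    using R_closed(6)[OF d(3)] by (auto simp: principal_eq mult.assoc)
  then show "\<exists>d\<in>R. d \<noteq> 0 \<and> (\<forall>x\<in>principal a. d * x \<in> R)" using d by blast
qed

lemma frac_R: "is_frac R"
  using frac_principal[OF one_F] by (simp add: principal_1)

lemma iprod_principal:
  assumes I: "is_frac I"
  shows "principal a \<odot> I = (\<lambda>x. a * x) ` I"
proof
  show "principal a \<odot> I \<subseteq> (\<lambda>x. a * x) ` I"
  proof (rule iprod_subsetI)
    fix x y assume "x \<in> principal a" and y: "y \<in> I"
    then obtain r where r: "r \<in> R" "x = a * r" unfolding principal_eq by blast
    then have "x * y = a * (r * y)" by simp
    then show "x * y \<in> (\<lambda>x. a * x) ` I" using frac_scale[OF I r(1) y] by blast
  next
    fix x y assume "x \<in> (\<lambda>x. a * x) ` I" "y \<in> (\<lambda>x. a * x) ` I"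
    then obtain r s where rs: "r \<in> I" "s \<in> I" "x = a * r" "y = a * s" by blast
    then have "x + y = a * (r + s)" by (simp add: distrib_left)
    then show "x + y \<in> (\<lambda>x. a * x) ` I" using frac_add[OF I rs(1,2)] by blast
  qed
  show "(\<lambda>x. a * x) ` I \<subseteq> principal a \<odot> I"
  proof
    fix y assume "y \<in> (\<lambda>x. a * x) ` I"
    then obtain x where x: "x \<in> I" "y = a * x" by blast
    have "a \<in> principal a" unfolding principal_eq using R_closed(2) by (auto simp: image_iff intro: bexI[of _ 1])
    then show "y \<in> principal a \<odot> I" using iprodI x by blast
  qed
qed

lemma iprod_R: "is_frac I \<Longrightarrow> R \<odot> I = I"
  using iprod_principal[of I 1] by (simp add: principal_1)

lemma principal_mult:
  assumes "b \<in> F" "b \<noteq> 0"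
  shows "principal a \<odot> principal b = principal (a * b)"
  using iprod_principal[OF frac_principal[OF assms]] by (simp add: principal_eq image_image mult.assoc)

text \<open>With a common denominator \<open>d\<close>, \<open>I\<close> lies in
  \<open>R / d\<close>, which is contained in the finitely generated group spanned by the
  \<open>t / d\<close>.\<close>

lemma frac_finitely_generated:
  assumes I: "is_frac I"
  shows "\<exists>S. finite S \<and> I = zmod.span S"
proof -
  obtain d where d: "d \<in> R" "d \<noteq> 0" "\<And>x. x \<in> I \<Longrightarrow> d * x \<in> R"
    using frac_denominator[OF I] by blast
  define S where "S = (\<lambda>t. inverse d * t) ` T"
  have "inverse d * w \<in> zmod.span S" if "w \<in> zmod.span T" for w
    by (rule zspan_mult_closed[OF _ that]) (auto simp: S_def intro: zmod.span_base)
  moreover have "x = inverse d * (d * x)" for x using d(2) by simp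
  ultimately have "I \<subseteq> zmod.span S"
    using d(3) R_subset_span by (metis subset_iff)
  moreover have "finite S" unfolding S_def using finite_T by blast
  ultimately show ?thesis
    using zsubspace_finitely_generated[OF _ zsubspace_frac[OF I]] by blast
qed

text \<open>Finite generation of \<open>M\<close> is used twice. Each element of \<open>B\<close>
  maps \<open>M\<close> into itself, so it is an algebraic integer and \<open>B\<close> is contained
  in \<open>R\<close>. Conversely, writing the generators of \<open>M = B M\<close> with
  coefficients in \<open>B\<close> puts 1 into \<open>B\<close>.\<close>

lemma iprod_cancel:
  assumes B: "is_frac B" and M: "is_frac M" and eq: "B \<odot> M = M"
  shows "B = R"
proof -
  obtain S where S: "finite S" "M = zmod.span S"
    using frac_finitely_generated[OF M] by blast
  have S_M: "s \<in> M" if "s \<in> S" for s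
    unfolding S(2) using that by (rule zmod.span_base)
  have nz: "\<exists>s\<in>S. s \<noteq> 0"
  proof (rule ccontr)
    assume "\<not> (\<exists>s\<in>S. s \<noteq> 0)"
    then have "zmod.span S \<subseteq> {0}"
      by (intro zmod.span_minimal) (auto simp: zmod.subspace_def)
    then show False using frac_nonzero[OF M] S(2) by blast
  qed
  have "B \<subseteq> R"
  proof
    fix b assume b: "b \<in> B"
    have "algebraic_int b"
      by (rule algebraic_int_if_stable[OF S(1) nz]) (metis iprodI[OF b S_M] eq S(2))
    then show "b \<in> R" using b frac_subset[OF B] mem_R by blast
  qed
  \<comment> \<open>The \<open>B\<close>-linear combinations of the generators; they exhaust
    \<open>B M\<close> because an integer multiple of an element of \<open>B\<close> is again in
    \<open>B\<close>.\<close>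
  define C where "C = {x. \<exists>b. (\<forall>t\<in>S. b t \<in> B) \<and> x = (\<Sum>t\<in>S. b t * t)}"
  have "B \<odot> M \<subseteq> C"
  proof (rule iprod_subsetI)
    fix x m assume x: "x \<in> B" and "m \<in> M"
    then obtain c where c: "m = (\<Sum>t\<in>S. of_int (c t) * t)"
      using S zmod.span_finite[OF S(1)] by auto
    have "x * m = (\<Sum>t\<in>S. (of_int (c t) * x) * t)"
      unfolding c sum_distrib_left by (simp add: mult_ac)
    moreover have "\<forall>t\<in>S. of_int (c t) * x \<in> B" using frac_scale_int[OF B x] by blast
    ultimately show "x * m \<in> C"
      unfolding C_def by (intro CollectI exI[of _ "\<lambda>t. of_int (c t) * x"]) blast
  next
    fix x y assume "x \<in> C" "y \<in> C"
    then obtain b c where "\<forall>t\<in>S. b t \<in> B" "x = (\<Sum>t\<in>S. b t * t)" "\<forall>t\<in>S. c t \<in> B" "y = (\<Sum>t\<in>S. c t * t)"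
      unfolding C_def by blast
    then show "x + y \<in> C"
      unfolding C_def
      by (intro CollectI exI[of _ "\<lambda>t. b t + c t"]) (simp add: distrib_right sum.distrib frac_add[OF B])
  qed
  then have "\<exists>b. (\<forall>t\<in>S. b t \<in> B) \<and> s = (\<Sum>t\<in>S. b t * t)" if "s \<in> S" for s
    using S_M[OF that] eq unfolding C_def by blast
  then obtain b where b: "\<And>s. s \<in> S \<Longrightarrow> (\<forall>t\<in>S. b s t \<in> B) \<and> s = (\<Sum>t\<in>S. b s t * t)"
    by metis
  have "1 \<in> B \<or> (\<forall>s\<in>S. s = 0)"
  proof (rule nakayama_field[OF S(1) frac_zero[OF B], of b])
    \<comment> \<open>A fractional ideal need not be closed under products; this one is, because it
      lies in \<open>R\<close>.\<close>
    show "x * y \<in> B" if "x \<in> B" "y \<in> B" for x y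
      using that \<open>B \<subseteq> R\<close> frac_scale[OF B] by blast
  qed (use b frac_diff[OF B] in blast)+
  then have "1 \<in> B" using nz by blast
  then have "R \<subseteq> B" using frac_scale[OF B, of _ 1] by auto
  with \<open>B \<subseteq> R\<close> show ?thesis by blast
qed

section \<open>The group of fractional ideals and its quotient\<close>

abbreviation G :: "complex set monoid" where
  "G \<equiv> fractional_ideals K R"

abbreviation P :: "complex set set" where
  "P \<equiv> principal_fractional_ideals K R"

lemma G_simps: "carrier G = {I. is_frac I}" "I \<otimes>\<^bsub>G\<^esub> J = I \<odot> J" "\<one>\<^bsub>G\<^esub> = R"
  by (simp_all add: fractional_ideals_def fractional_ideal_iff)

lemma mem_P: "I \<in> P \<longleftrightarrow> (\<exists>a\<in>F. a \<noteq> 0 \<and> I = principal a)"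
  unfolding principal_fractional_ideals_def by auto

lemma comm_monoid_G: "comm_monoid G"
proof (rule comm_monoidI)
  fix I J L assume "I \<in> carrier G" "J \<in> carrier G" "L \<in> carrier G"
  show "I \<otimes>\<^bsub>G\<^esub> J \<otimes>\<^bsub>G\<^esub> L = I \<otimes>\<^bsub>G\<^esub> (J \<otimes>\<^bsub>G\<^esub> L)"
    by (simp only: G_simps iprod_assoc)
next
  fix I J assume "I \<in> carrier G" "J \<in> carrier G"
  show "I \<otimes>\<^bsub>G\<^esub> J = J \<otimes>\<^bsub>G\<^esub> I"
    unfolding G_simps by (rule iprod_commute)
qed (simp_all add: G_simps frac_iprod frac_R iprod_R)

text \<open>If there are finitely many classes, then \<open>I\<^sup>i = a I\<^sup>k I\<^sup>i\<close> for some \<open>i\<close> and \<open>k > 0\<close>, so \<open>a I\<^sup>k = R\<close>.\<close>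
lemma comm_group_G:
  assumes "class_number K R \<noteq> 0"
  shows "comm_group G"
proof -
  interpret comm_monoid G by (rule comm_monoid_G)
  \<comment> \<open>At this point \<open>G\<close> is only a commutative monoid, so its cosets need
    not partition it; all that is extracted is that there are finitely many of them, an infinite set
    having cardinality 0.\<close>
  have fin: "finite (rcosets\<^bsub>G\<^esub> P)"
    using assms card.infinite
    unfolding class_number_def ideal_class_group_def Coset.order_def FactGroup_def by fastforce
  show ?thesis
  proof (rule comm_groupI)
    fix I assume I: "I \<in> carrier G"
    define f where "f n = P #>\<^bsub>G\<^esub> (I [^]\<^bsub>G\<^esub> (n::nat))" for n
    have "range f \<subseteq> rcosets\<^bsub>G\<^esub> P"
      unfolding f_def RCOSETS_def using I by blast
    then have "\<not> inj f"
      using fin finite_imageD finite_subset infinite_UNIV_nat by blast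
    then obtain i j where ij: "i < j" "f i = f j"
      unfolding inj_def by (metis linorder_neqE_nat)
    obtain k where k: "j = Suc (k + i)"
      using ij(1) by (metis add.commute less_imp_Suc_add)
    have car: "I [^]\<^bsub>G\<^esub> n \<in> carrier G" for n :: nat using I by simp
    have "R \<in> P" using principal_1 one_F mem_P by (metis zero_neq_one)
    moreover have "R \<otimes>\<^bsub>G\<^esub> (I [^]\<^bsub>G\<^esub> i) = I [^]\<^bsub>G\<^esub> i"
      using l_one[OF car[of i]] by (simp only: G_simps(3))
    \<comment> \<open>Since \<open>R\<close> is in \<open>P\<close>, the power \<open>I^i\<close>
      lies in its own coset and therefore in the equal coset of \<open>I^j\<close>.\<close>
    ultimately have "I [^]\<^bsub>G\<^esub> i \<in> f i"
      unfolding f_def r_coset_def by blast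
    then obtain A where A: "A \<in> P" "I [^]\<^bsub>G\<^esub> i = A \<otimes>\<^bsub>G\<^esub> (I [^]\<^bsub>G\<^esub> j)"
      unfolding ij(2) unfolding f_def r_coset_def by blast
    have A_car: "A \<in> carrier G" using A(1) mem_P frac_principal G_simps(1) by auto
    define B where "B = A \<otimes>\<^bsub>G\<^esub> (I [^]\<^bsub>G\<^esub> k)"
    have B: "B \<in> carrier G" unfolding B_def using A_car car by simp
    have "I [^]\<^bsub>G\<^esub> j = I [^]\<^bsub>G\<^esub> k \<otimes>\<^bsub>G\<^esub> I \<otimes>\<^bsub>G\<^esub> I [^]\<^bsub>G\<^esub> i"
      unfolding k using nat_pow_mult[OF I, of "Suc k" i] by simp
    then have "(B \<otimes>\<^bsub>G\<^esub> I) \<otimes>\<^bsub>G\<^esub> I [^]\<^bsub>G\<^esub> i = I [^]\<^bsub>G\<^esub> i"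
      unfolding B_def using A(2) A_car car I by (simp add: m_assoc)
    then have "B \<otimes>\<^bsub>G\<^esub> I = R"
      using iprod_cancel[of "B \<odot> I" "I [^]\<^bsub>G\<^esub> i"] B I car frac_iprod unfolding G_simps by blast
    then show "\<exists>y\<in>carrier G. y \<otimes>\<^bsub>G\<^esub> I = \<one>\<^bsub>G\<^esub>"
      using B unfolding G_simps(3) by blast
  qed (simp_all add: m_ac)
qed

lemma subgroup_P:
  assumes "class_number K R \<noteq> 0"
  shows "subgroup P G"
proof -
  interpret comm_group G by (rule comm_group_G[OF assms])
  show ?thesis
  proof (rule subgroupI)
    show "P \<subseteq> carrier G" using mem_P frac_principal G_simps(1) by auto
    show "P \<noteq> {}" using mem_P one_F by fastforce
    fix A assume "A \<in> P"
    then obtain a where a: "a \<in> F" "a \<noteq> 0" "A = principal a" using mem_P by blast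
    have ia: "inverse a \<in> F" "inverse a \<noteq> 0" using a inverse_F by auto
    have "principal (inverse a) \<otimes>\<^bsub>G\<^esub> principal a = \<one>\<^bsub>G\<^esub>"
      unfolding G_simps principal_mult[OF a(1,2)] using a(2) by (simp add: principal_1)
    then have "inv\<^bsub>G\<^esub> A = principal (inverse a)"
      unfolding a(3) using a ia by (intro inv_equality) (auto simp: G_simps frac_principal)
    then show "inv\<^bsub>G\<^esub> A \<in> P" using ia mem_P by blast
    fix A' assume "A' \<in> P"
    then obtain b where b: "b \<in> F" "b \<noteq> 0" "A' = principal b" using mem_P by blast
    have "A \<otimes>\<^bsub>G\<^esub> A' = principal (a * b)"
      unfolding a(3) b(3) G_simps by (rule principal_mult[OF b(1,2)])
    then show "A \<otimes>\<^bsub>G\<^esub> A' \<in> P" using a b mult_F mem_P by (metis mult_eq_0_iff)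
  qed
qed

text \<open>The order of the class of \<open>I\<close> divides \<open>n\<close> and, by Lagrange,
  the class number, so it is 1.\<close>

lemma principal_if_power_principal:
  fixes n :: nat
  assumes h: "class_number K R \<noteq> 0" "Rings.coprime n (class_number K R)"
    and I: "I \<in> carrier G" and pow: "I [^]\<^bsub>G\<^esub> n \<in> P"
  shows "I \<in> P"
proof -
  interpret comm_group G by (rule comm_group_G[OF h(1)])
  have sub: "subgroup P G" by (rule subgroup_P[OF h(1)])
  have norm: "P \<lhd> G" by (rule subgroup_imp_normal[OF sub])
  interpret Q: group "G Mod P" by (rule normal.factorgroup_is_group[OF norm])
  define C where "C = P #>\<^bsub>G\<^esub> I"
  have C: "C \<in> carrier (G Mod P)" unfolding C_def carrier_FactGroup using I by blast
  have "C [^]\<^bsub>G Mod P\<^esub> n = P #>\<^bsub>G\<^esub> (I [^]\<^bsub>G\<^esub> n)"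
    unfolding C_def by (rule normal.FactGroup_pow[OF norm I])
  also have "\<dots> = \<one>\<^bsub>G Mod P\<^esub>"
    unfolding one_FactGroup by (rule subgroup.rcos_const[OF sub is_group pow])
  finally have "Q.ord C dvd n" using Q.pow_eq_id[OF C] by blast
  moreover have "Q.ord C dvd class_number K R"
    unfolding class_number_def ideal_class_group_def using Q.ord_dvd_group_order[OF C] .
  ultimately have "Q.ord C = 1" using h(2)
    by (metis coprime_common_divisor_nat)
  then have "C = P" using Q.ord_eq_1[OF C] by simp
  then show ?thesis unfolding C_def using rcos_self[OF I sub] by blast
qed

text \<open>The last equation assumed is a Bezout relation between \<open>a^(n-1)\<close> and
  \<open>b\<close>, multiplied by \<open>a\<close>. It is what places \<open>a\<close> itself in the
  \<open>n\<close>-th power of the ideal \<open>(a, z)\<close>.\<close>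

theorem coprime_factor_is_power:
  assumes h: "class_number K R \<noteq> 0" "Rings.coprime n (class_number K R)" "n > 0"
    and R: "a \<in> R" "b \<in> R" "z \<in> R" "s \<in> R" "t \<in> R"
    and a: "a \<noteq> 0" and ab: "a * b = z ^ n" and coprime: "s * a ^ n + t * (a * b) = a"
  obtains u g where "u \<in> R" "inverse u \<in> R" "u \<noteq> 0" "g \<in> R" "a = u * g ^ n"
proof -
  define I where "I = {a * r + z * s | r s. r \<in> R \<and> s \<in> R}"
  interpret comm_group G by (rule comm_group_G[OF h(1)])
  have IR: "I \<subseteq> R" unfolding I_def by (auto intro!: R_closed(4,6) R)
  have "a * 1 + z * 0 \<in> I" "a * 0 + z * 1 \<in> I" "a * 0 + z * 0 \<in> I"
    unfolding I_def using R_closed(1,2) by blast+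
  then have aI: "a \<in> I" and zI: "z \<in> I" and 0: "0 \<in> I" by simp_all
  have I: "is_frac I" unfolding is_frac_def
  proof (intro conjI)
    show "I \<subseteq> F" using IR mem_R by blast
    show "0 \<in> I" by (rule 0)
    show "\<forall>x\<in>I. \<forall>y\<in>I. x + y \<in> I"
    proof (intro ballI)
      fix x y assume "x \<in> I" "y \<in> I"
      then obtain r s r' s' where rs: "r \<in> R" "s \<in> R" "r' \<in> R" "s' \<in> R"
        "x = a * r + z * s" "y = a * r' + z * s'" unfolding I_def by blast
      then have "x + y = a * (r + r') + z * (s + s')" by (simp add: algebra_simps)
      then show "x + y \<in> I" unfolding I_def using rs R_closed(4) by blast
    qed
    show "\<forall>q\<in>R. \<forall>x\<in>I. q * x \<in> I"
    proof (intro ballI)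
      fix q x assume "q \<in> R" "x \<in> I"
      then obtain r s where rs: "r \<in> R" "s \<in> R" "x = a * r + z * s" unfolding I_def by blast
      then have "q * x = a * (q * r) + z * (q * s)" by (simp add: algebra_simps)
      then show "q * x \<in> I" unfolding I_def using rs \<open>q \<in> R\<close> R_closed(6) by blast
    qed
    show "\<exists>x\<in>I. x \<noteq> 0" using aI a by blast
    show "\<exists>d\<in>R. d \<noteq> 0 \<and> (\<forall>x\<in>I. d * x \<in> R)"
      using IR R_closed(2) by (intro bexI[of _ 1]) auto
  qed
  then have I_car: "I \<in> carrier G" by (simp add: G_simps)
  have pow_frac: "is_frac (I [^]\<^bsub>G\<^esub> k)" for k :: nat
    using nat_pow_closed[OF I_car] by (simp add: G_simps)
  have pow_mem: "x ^ k \<in> I [^]\<^bsub>G\<^esub> k" if "x \<in> I" for x and k :: nat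
  proof (induction k)
    case 0
    then show ?case using R_closed(2) by (simp add: G_simps)
  next
    case (Suc k)
    then show ?case using iprodI[OF Suc that] by (simp add: G_simps mult.commute)
  qed
  \<comment> \<open>In a product of \<open>k\<close> elements \<open>a r + z s\<close>, every term
    except the one with \<open>z^k\<close> contains \<open>a\<close>. Factoring out a single
    \<open>a\<close> suffices, as \<open>z^n\<close> is a multiple of \<open>a\<close> too.\<close>
  have pow_sub: "I [^]\<^bsub>G\<^esub> k \<subseteq> {a * r + z ^ k * s | r s. r \<in> R \<and> s \<in> R}" for k :: nat
  proof (induction k)
    case 0
    have "r = a * 0 + z ^ 0 * r" for r by simp
    then show ?case using R_closed(1) unfolding nat_pow_0 G_simps(3) by blast
  next
    case (Suc k)
    have "I [^]\<^bsub>G\<^esub> k \<odot> I \<subseteq> {a * r + z ^ Suc k * s | r s. r \<in> R \<and> s \<in> R}"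
    proof (rule iprod_subsetI)
      fix x y assume x: "x \<in> I [^]\<^bsub>G\<^esub> k" and y: "y \<in> I"
      obtain r s r' s' where rs: "r \<in> R" "s \<in> R" "r' \<in> R" "s' \<in> R"
        "x = a * r + z ^ k * s" "y = a * r' + z * s'"
        using subsetD[OF Suc x] y unfolding I_def by blast
      have "x * y = a * (r * y + z ^ k * s * r') + z ^ Suc k * (s * s')"
        unfolding rs(5,6) by (simp add: algebra_simps)
      moreover have "r * y + z ^ k * s * r' \<in> R" "s * s' \<in> R"
        using rs(1-4) y IR R(3) by (auto intro!: R_closed power_R)
      ultimately show "x * y \<in> {a * r + z ^ Suc k * s | r s. r \<in> R \<and> s \<in> R}" by blast
    next
      fix x y assume "x \<in> {a * r + z ^ Suc k * s | r s. r \<in> R \<and> s \<in> R}"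
        "y \<in> {a * r + z ^ Suc k * s | r s. r \<in> R \<and> s \<in> R}"
      then obtain r s r' s' where rs: "r \<in> R" "s \<in> R" "r' \<in> R" "s' \<in> R"
        "x = a * r + z ^ Suc k * s" "y = a * r' + z ^ Suc k * s'" by blast
      have "x + y = a * (r + r') + z ^ Suc k * (s + s')" unfolding rs(5,6) by (simp add: algebra_simps)
      then show "x + y \<in> {a * r + z ^ Suc k * s | r s. r \<in> R \<and> s \<in> R}" using rs R_closed(4) by blast
    qed
    then show ?case by (simp add: G_simps)
  qed
  have "I [^]\<^bsub>G\<^esub> n = principal a"
  proof
    show "I [^]\<^bsub>G\<^esub> n \<subseteq> principal a"
    proof
      fix x assume "x \<in> I [^]\<^bsub>G\<^esub> n"
      then obtain r s where rs: "r \<in> R" "s \<in> R" "x = a * r + z ^ n * s" using pow_sub by blast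
      then have "x = a * (r + b * s)" unfolding ab[symmetric] by (simp add: algebra_simps)
      then show "x \<in> principal a" unfolding principal_eq using rs R R_closed(4,6) by blast
    qed
    \<comment> \<open>Both \<open>a^n\<close> and \<open>z^n\<close> are \<open>n\<close>-th powers
      of elements of \<open>I\<close>, and by the Bezout relation this combination equals
      \<open>a\<close>.\<close>
    have "s * a ^ n + t * z ^ n \<in> I [^]\<^bsub>G\<^esub> n"
      by (intro frac_add[OF pow_frac] frac_scale[OF pow_frac] pow_mem aI zI R)
    then have "a \<in> I [^]\<^bsub>G\<^esub> n" using coprime ab by simp
    then show "principal a \<subseteq> I [^]\<^bsub>G\<^esub> n"
      unfolding principal_eq using frac_scale[OF pow_frac] by (auto simp: mult.commute)
  qed
  then have "I [^]\<^bsub>G\<^esub> n \<in> P" using mem_P R(1) mem_R a by blast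
  then have "I \<in> P" by (rule principal_if_power_principal[OF h(1,2) I_car])
  then obtain g where g: "g \<in> F" "g \<noteq> 0" "I = principal g" using mem_P by blast
  have gn: "g ^ k \<in> F" for k by (induction k) (simp_all add: one_F mult_F g)
  have "principal g [^]\<^bsub>G\<^esub> k = principal (g ^ k)" for k :: nat
  proof (induction k)
    case 0
    show ?case by (simp add: G_simps principal_1)
  next
    case (Suc k)
    then show ?case using principal_mult[OF g(1,2)] by (simp add: G_simps mult.commute)
  qed
  then have eq: "principal a = principal (g ^ n)"
    using \<open>I [^]\<^bsub>G\<^esub> n = principal a\<close> g(3) by simp
  have self: "x \<in> principal x" for x
    unfolding principal_eq using R_closed(2) by (auto simp: image_iff intro: bexI[of _ 1])
  \<comment> \<open>Each of \<open>a\<close> and \<open>g^n\<close> is a multiple of the other, so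
    the quotients \<open>u\<close> and \<open>v\<close> are mutually inverse units.\<close>
  have "a \<in> (\<lambda>r. g ^ n * r) ` R" "g ^ n \<in> (\<lambda>r. a * r) ` R"
    using self[of a] self[of "g ^ n"] eq by (simp_all only: principal_eq)
  then obtain u v where u: "u \<in> R" "a = g ^ n * u" and v: "v \<in> R" "g ^ n = a * v"
    by (elim imageE)
  have "a * (v * u) = g ^ n * u" by (simp add: v(2) mult.assoc)
  then have "a * (v * u) = a * 1" using u(2) by simp
  then have "v * u = 1" using a mult_left_cancel by blast
  then have "u * v = 1" by (simp only: mult.commute)
  then have "inverse u = v" "u \<noteq> 0" by (auto simp: inverse_unique)
  moreover have "g \<in> R" using self[of g] IR g(3) by blast
  moreover have "a = u * g ^ n" using u(2) by (simp only: mult.commute)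
  ultimately show thesis using that[of u g] u(1) v(1) by blast
qed

end

section \<open>Prime cyclotomic fields\<close>

text \<open>Divisibility is taken in the ring of all algebraic integers in \<open>\<complex>\<close>, so that it does not matter
  in which field a quotient lies.\<close>
definition adv :: "complex \<Rightarrow> complex \<Rightarrow> bool" (infix "adv" 50) where
  "d adv x \<longleftrightarrow> (\<exists>b. algebraic_int b \<and> x = d * b)"

lemma advI: "algebraic_int b \<Longrightarrow> d adv d * b"
  unfolding adv_def by blast

lemma adv_refl [simp]: "d adv d"
  using advI[of 1 d] by simp

lemma adv_0 [simp]: "d adv 0"
  using advI[of 0 d] by simp

lemma adv_add: "d adv x \<Longrightarrow> d adv y \<Longrightarrow> d adv x + y"
  unfolding adv_def by (metis algebraic_int_plus_complex distrib_left)

lemma adv_uminus: "d adv x \<Longrightarrow> d adv - x"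
  unfolding adv_def by (metis algebraic_int_minus mult_minus_right)

lemma adv_diff: "d adv x \<Longrightarrow> d adv y \<Longrightarrow> d adv x - y"
  using adv_add[of d x "- y"] adv_uminus by simp

lemma adv_mult_right: "d adv x \<Longrightarrow> algebraic_int y \<Longrightarrow> d adv x * y"
  unfolding adv_def by (metis algebraic_int_times_complex mult.assoc)

lemma adv_mult_left: "d adv x \<Longrightarrow> algebraic_int y \<Longrightarrow> d adv y * x"
  using adv_mult_right[of d x y] by (simp add: mult.commute)

lemma adv_trans: "d adv e \<Longrightarrow> e adv x \<Longrightarrow> d adv x"
  unfolding adv_def by (metis algebraic_int_times_complex mult.assoc)

lemma adv_mult_mono: "d adv x \<Longrightarrow> e adv y \<Longrightarrow> d * e adv x * y"
proof -
  assume "d adv x" "e adv y"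
  then obtain a b where "algebraic_int a" "algebraic_int b" "x = d * a" "y = e * b"
    unfolding adv_def by blast
  then show ?thesis
    using advI[OF algebraic_int_times_complex[of a b], of "d * e"] by (simp add: mult_ac)
qed

lemma adv_power_mono: "d adv x \<Longrightarrow> d ^ n adv x ^ n"
  by (induction n) (simp_all add: adv_mult_mono)

lemma adv_prod_mono: "(\<And>i. i \<in> I \<Longrightarrow> f i adv g i) \<Longrightarrow> prod f I adv prod g I"
  by (induction I rule: infinite_finite_induct) (simp_all add: adv_mult_mono)

lemma adv_sum: "(\<And>i. i \<in> I \<Longrightarrow> d adv f i) \<Longrightarrow> d adv sum f I"
  by (induction I rule: infinite_finite_induct) (simp_all add: adv_add)

lemma adv_cancel: "d \<noteq> 0 \<Longrightarrow> d * x adv d * y \<Longrightarrow> x adv y"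
  unfolding adv_def by (metis mult.assoc mult_left_cancel)

lemma adv_one_minus_power: "algebraic_int x \<Longrightarrow> 1 - x adv 1 - x ^ n"
  unfolding one_diff_power_eq by (intro advI algebraic_int_sum_complex algebraic_int_power_complex)

section \<open>The \<open>p\<close>-th roots of unity\<close>

locale prime_cyclotomic =
  fixes p :: nat and \<zeta> :: complex
  assumes prime_p: "prime p" and odd_p: "odd p"
    and zeta_eq: "\<zeta> = exp (2 * of_real pi * \<i> / of_nat p)"
begin

abbreviation lam :: complex where "lam \<equiv> 1 - \<zeta>"

lemma p_ge_3: "p \<ge> 3"
  using prime_p odd_p prime_ge_2_nat[of p] by (cases "p = 2") auto

lemma p_pos [simp]: "p > 0"
  using p_ge_3 by simp

lemma zeta_power: "\<zeta> ^ k = cis (2 * pi * real k / real p)"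
proof -
  have "\<zeta> = cis (2 * pi / real p)"
    unfolding zeta_eq cis_conv_exp by (simp add: mult_ac)
  then show ?thesis by (simp add: Complex.DeMoivre mult_ac)
qed

lemma bij_betw_zeta_power: "bij_betw (\<lambda>k. \<zeta> ^ k) {..<p} {z. z ^ p = 1}"
  unfolding zeta_power using p_ge_3 by (intro bij_betw_roots_unity) simp

lemma zeta_power_p [simp]: "\<zeta> ^ p = 1"
  unfolding zeta_power using p_ge_3 by simp

lemma zeta_power_power_p [simp]: "(\<zeta> ^ k) ^ p = 1"
  unfolding power_mult[symmetric] mult.commute[of k] by (simp add: power_mult)

lemma zeta_power_mod: "\<zeta> ^ (k mod p) = \<zeta> ^ k"
proof -
  have "\<zeta> ^ k = \<zeta> ^ (p * (k div p) + k mod p)" by simp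
  also have "\<dots> = \<zeta> ^ (k mod p)" unfolding power_add power_mult by simp
  finally show ?thesis by simp
qed

lemma zeta_power_eq_1_iff: "\<zeta> ^ k = 1 \<longleftrightarrow> p dvd k"
proof -
  have "\<zeta> ^ (k mod p) = \<zeta> ^ 0 \<longleftrightarrow> k mod p = 0"
    using bij_betw_zeta_power p_ge_3 by (intro inj_on_eq_iff[of _ "{..<p}"]) (auto simp: bij_betw_def)
  then show ?thesis by (simp add: zeta_power_mod dvd_eq_mod_eq_0)
qed

lemma root_of_unity_cases:
  assumes "z ^ p = 1"
  obtains k where "k < p" "z = \<zeta> ^ k"
  using bij_betw_zeta_power assms unfolding bij_betw_def by blast

lemma zeta_neq_0 [simp]: "\<zeta> \<noteq> 0"
  unfolding zeta_eq by simp

lemma zeta_neq_1: "\<zeta> \<noteq> 1"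
  using zeta_power_eq_1_iff[of 1] p_ge_3 by simp

lemma lam_neq_0: "lam \<noteq> 0"
  using zeta_neq_1 by simp

lemma algebraic_int_zeta [simp]: "algebraic_int \<zeta>"
proof -
  have "ieval (Polynomial.monom 1 p - 1) \<zeta> = 0" by simp
  moreover have "lead_coeff (Polynomial.monom 1 p - 1 :: int poly) = 1"
  proof -
    have "Polynomial.degree (Polynomial.monom 1 p - 1 :: int poly) = p"
      using p_ge_3 by (subst diff_conv_add_uminus, subst degree_add_eq_left) (simp_all add: Polynomial.degree_monom_eq)
    then show ?thesis using p_ge_3 by simp
  qed
  ultimately show ?thesis unfolding algebraic_int_iff_ieval by blast
qed

lemma algebraic_int_zeta_power [simp]: "algebraic_int (\<zeta> ^ k)"
  by (simp add: algebraic_int_power_complex)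

lemma algebraic_int_lam [simp]: "algebraic_int lam"
  by (simp add: algebraic_int_diff_complex)

lemma sum_root_powers: "w ^ p = 1 \<Longrightarrow> w \<noteq> 1 \<Longrightarrow> (\<Sum>i<p. w ^ i) = (0::complex)"
  by (simp add: sum_gp_strict)

text \<open>Both sides are monic of degree \<open>p\<close> in \<open>x\<close> and agree at the
  \<open>p\<close> distinct roots of unity.\<close>

lemma prod_x_minus_zeta: "(\<Prod>k<p. x - \<zeta> ^ k) = x ^ p - 1"
proof -
  define q where "q = (\<Prod>k<p. [:- (\<zeta> ^ k), 1:])"
  define r :: "complex poly" where "r = Polynomial.monom 1 p - 1"
  have deg_q: "Polynomial.degree q = p" and lead_q: "lead_coeff q = 1"
    unfolding q_def by (subst degree_prod_eq_sum_degree) (simp_all add: lead_coeff_prod)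
  have "q = r"
  proof (rule poly_eqI_degree_lead_coeff)
    show "poly.coeff q p = poly.coeff r p"
      using deg_q lead_q p_ge_3 by (simp add: r_def)
    show "p \<le> card ((\<lambda>k. \<zeta> ^ k) ` {..<p})"
      unfolding card_image[OF bij_betw_imp_inj_on[OF bij_betw_zeta_power]] by simp
    show "Polynomial.degree q \<le> p" using deg_q by simp
    show "Polynomial.degree r \<le> p"
      unfolding r_def by (intro degree_diff_le) (simp_all add: degree_monom_le)
    fix z assume "z \<in> (\<lambda>k. \<zeta> ^ k) ` {..<p}"
    then obtain k where k: "k < p" "z = \<zeta> ^ k" by blast
    have "poly q z = 0" unfolding q_def poly_prod using k by (intro prod_zero) auto
    moreover have "poly r z = 0" unfolding r_def by (simp add: k poly_monom)
    ultimately show "poly q z = poly r z" by simp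
  qed
  then have "poly q x = poly r x" by simp
  then show ?thesis by (simp add: q_def r_def poly_prod poly_monom)
qed

lemma prod_plus_zeta: "(\<Prod>k<p. x + \<zeta> ^ k * y) = x ^ p + y ^ p"
proof (cases "y = 0")
  case False
  have "(\<Prod>k<p. x + \<zeta> ^ k * y) = (\<Prod>k<p. (- y) * ((- x / y) - \<zeta> ^ k))"
    using False by (intro prod.cong) (auto simp: field_simps)
  also have "\<dots> = (- y) ^ p * ((- x / y) ^ p - 1)"
    by (simp only: prod.distrib prod_x_minus_zeta) simp
  also have "\<dots> = x ^ p + y ^ p"
    using False odd_p by (simp add: field_simps power_divide)
  finally show ?thesis .
qed simp

lemma lessThan_p: "{..<p} = insert 0 {1..<p}"
  using p_ge_3 by auto

text \<open>Cancel \<open>X - 1\<close> from the factorization of \<open>X^p - 1\<close> as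
  polynomials and evaluate the quotient \<open>1 + X + ... + X^(p-1)\<close> at 1.\<close>

lemma prod_one_minus_zeta: "(\<Prod>k=1..<p. 1 - \<zeta> ^ k) = of_nat p"
proof -
  define q where "q = (\<Prod>k=1..<p. [:- (\<zeta> ^ k), 1:])"
  define r :: "complex poly" where "r = (\<Sum>i<p. Polynomial.monom 1 i)"
  have "[:-1, 1:] * q = (\<Prod>k<p. [:- (\<zeta> ^ k), 1:])"
    unfolding q_def lessThan_p by simp
  moreover have "[:-1, 1:] * r = Polynomial.monom 1 p - 1"
  proof (rule poly_eqI)
    fix i
    have "poly.coeff r i = (if i < p then 1 else 0)" for i
      by (simp add: r_def coeff_sum)
    then show "poly.coeff ([:-1, 1:] * r) i = poly.coeff (Polynomial.monom 1 p - 1) i"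
      using p_ge_3 by (cases i) auto
  qed
  moreover have "(\<Prod>k<p. [:- (\<zeta> ^ k), 1:]) = Polynomial.monom 1 p - 1"
    by (rule poly_ext) (simp add: poly_prod prod_x_minus_zeta poly_monom)
  ultimately have "[:-1, 1:] * q = [:-1, 1:] * r" by simp
  then have "q = r" by (subst (asm) mult_left_cancel) auto
  then have "poly q 1 = poly r 1" by simp
  then show ?thesis by (simp add: q_def r_def poly_prod poly_sum poly_monom)
qed

section \<open>Divisibility by \<open>lam\<close>\<close>

lemma lam_adv_one_minus: "lam adv 1 - \<zeta> ^ k"
  by (rule adv_one_minus_power) simp

text \<open>If \<open>m\<close> inverts \<open>k\<close> modulo \<open>p\<close>, then \<zeta> is
  the \<open>m\<close>-th power of \<zeta>^k. So all factors 1 - \<zeta>^k with \<open>k\<close>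
  prime to \<open>p\<close> are associates of \<open>lam\<close>, and their product \<open>p\<close>
  is an associate of \<open>lam^(p-1)\<close>.\<close>

lemma one_minus_adv_lam:
  assumes "\<not> p dvd k"
  shows "1 - \<zeta> ^ k adv lam"
proof -
  have "Rings.coprime p k"
    using prime_p assms by (rule prime_imp_coprime)
  then have gcd: "gcd k p = 1"
    unfolding coprime_iff_gcd_eq_1 by (subst gcd.commute)
  have "k \<noteq> 0" using assms by (intro notI) simp
  then obtain m n where "k * m = p * n + 1" using bezout_nat[of k p] gcd by auto
  then have "(\<zeta> ^ k) ^ m = \<zeta> ^ (p * n + 1)" by (simp only: power_mult[symmetric])
  also have "\<dots> = \<zeta>" by (simp only: power_add power_mult zeta_power_p) simp
  finally show ?thesis using adv_one_minus_power[of "\<zeta> ^ k" m] by simp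
qed

lemma lam_power_adv_p: "lam ^ (p - 1) adv of_nat p"
proof -
  have "(\<Prod>k=1..<p. lam) adv (\<Prod>k=1..<p. 1 - \<zeta> ^ k)"
    by (rule adv_prod_mono) (rule lam_adv_one_minus)
  then show ?thesis unfolding prod_one_minus_zeta by simp
qed

lemma p_adv_lam_power: "of_nat p adv lam ^ (p - 1)"
proof -
  have "(\<Prod>k=1..<p. 1 - \<zeta> ^ k) adv (\<Prod>k=1..<p. lam)"
    by (rule adv_prod_mono) (use one_minus_adv_lam nat_dvd_not_less in fastforce)
  then show ?thesis unfolding prod_one_minus_zeta by simp
qed

lemma lam_power_adv_lam_power:
  assumes "m \<le> n"
  shows "lam ^ m adv lam ^ n"
proof -
  have "lam ^ n = lam ^ m * lam ^ (n - m)" using assms by (simp flip: power_add)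
  then show ?thesis by (simp add: advI algebraic_int_power_complex)
qed

lemma lam_adv_p: "lam adv of_nat p"
  using adv_trans[OF lam_power_adv_lam_power lam_power_adv_p, of 1] p_ge_3 by simp

text \<open>If \<open>lam\<close> were a unit, so would be \<open>p\<close>; but \<open>1/p\<close>
  is rational and not an integer.\<close>

lemma not_lam_adv_1: "\<not> lam adv 1"
proof
  assume "lam adv 1"
  then have "lam ^ (p - 1) adv 1" using adv_power_mono[of lam 1 "p - 1"] by simp
  then have "of_nat p adv 1" using adv_trans[OF p_adv_lam_power] by blast
  then obtain b :: complex where b: "algebraic_int b" "of_nat p * b = 1" unfolding adv_def by metis
  then have "b = 1 / of_nat p" by (simp add: eq_divide_eq mult.commute)
  then have "b \<in> \<rat>" by simp
  then obtain n where "b = of_int n" using rational_algebraic_int_is_int b(1) by (auto elim: Ints_cases)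
  then have "of_int (int p * n) = (1::complex)" using b(2) by (simp only: of_int_mult of_int_of_nat_eq)
  then have "int p * n = 1" by (simp only: of_int_eq_1_iff)
  then show False using p_ge_3 by (auto simp: zmult_eq_1_iff)
qed

lemma lam_adv_int_iff: "lam adv of_int c \<longleftrightarrow> int p dvd c"
proof
  assume c: "lam adv of_int c"
  show "int p dvd c"
  proof (rule ccontr)
    assume "\<not> int p dvd c"
    then have "Rings.coprime (int p) c" using prime_p by (simp add: prime_imp_coprime)
    then obtain s t where st: "s * int p + t * c = 1" using bezout_int[of "int p" c] by auto
    have "lam adv of_int s * of_nat p + of_int t * of_int c"
      by (intro adv_add adv_mult_left c lam_adv_p) simp_all
    also have "of_int s * of_nat p + of_int t * of_int c = (of_int (s * int p + t * c) :: complex)" by simp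
    finally show False using st not_lam_adv_1 by simp
  qed
next
  assume "int p dvd c"
  then obtain k where "c = int p * k" by blast
  then show "lam adv of_int c" using adv_mult_right[OF lam_adv_p, of "of_int k"] by simp
qed

lemma lam_power_adv_int:
  assumes "n \<le> p - 1" "int p dvd c"
  shows "lam ^ n adv of_int c"
proof -
  obtain k where "c = int p * k" using assms(2) by blast
  then show ?thesis
    using adv_mult_right[OF adv_trans[OF lam_power_adv_lam_power[OF assms(1)] lam_power_adv_p], of "of_int k"]
    by simp
qed

text \<open>Expanding in powers of \<open>\<zeta> - 1\<close>: the lowest coefficient is divisible by \<open>\<lambda>\<close>, hence by \<open>p\<close>,
  hence by \<open>\<lambda>\<^sup>p\<^sup>-\<^sup>1\<close>, and can be removed.\<close>
lemma dvd_poly_if_lam_power_adv: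
  assumes "n \<le> p - 1" "\<forall>i\<ge>n. poly.coeff f i = 0" "lam ^ n adv ieval f \<zeta>"
  shows "[:int p:] dvd f"
  using assms
proof (induction n arbitrary: f)
  case 0
  then have "f = 0" by (intro poly_eqI) simp
  then show ?case by simp
next
  case (Suc n)
  define g where "g = synthetic_div f 1"
  define c where "c = poly f 1"
  have f: "f = [:-1, 1:] * g + [:c:]"
    unfolding g_def c_def by (rule synthetic_div_correct'[symmetric])
  have ev: "ieval f \<zeta> = of_int c - lam * ieval g \<zeta>"
    by (subst f, simp only: ieval_add ieval_mult) (simp add: algebra_simps)
  have alg: "algebraic_int (ieval g \<zeta>)" by (simp add: algebraic_int_ieval)
  have "lam adv ieval f \<zeta>"
    using adv_trans[OF lam_power_adv_lam_power[of 1 "Suc n"] Suc.prems(3)] by simp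
  then have "lam adv ieval f \<zeta> + lam * ieval g \<zeta>"
    by (intro adv_add advI alg)
  then have c: "int p dvd c" unfolding ev using lam_adv_int_iff by simp
  have "lam ^ Suc n adv of_int c - ieval f \<zeta>"
    by (intro adv_diff Suc.prems lam_power_adv_int c)
  then have "lam * lam ^ n adv lam * ieval g \<zeta>" unfolding ev by simp
  then have "lam ^ n adv ieval g \<zeta>" by (rule adv_cancel[OF lam_neq_0])
  moreover have "\<forall>i\<ge>n. poly.coeff g i = 0"
  proof (cases "Polynomial.degree f = 0")
    case True
    then have "g = 0" unfolding g_def by (simp add: synthetic_div_eq_0_iff)
    then show ?thesis by simp
  next
    case False
    have "Polynomial.degree f \<le> n"
      using Suc.prems(2) by (intro Polynomial.degree_le) auto
    then have "Polynomial.degree g < n" using False unfolding g_def degree_synthetic_div by simp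
    then show ?thesis by (auto intro: coeff_eq_0)
  qed
  ultimately have "[:int p:] dvd g" using Suc.IH[of g] Suc.prems(1) by simp
  moreover have "[:int p:] dvd [:c:]" using c by (auto simp: const_poly_dvd_iff coeff_pCons split: nat.splits)
  ultimately show ?case by (subst f) (intro dvd_add dvd_mult)
qed

text \<open>The quotient by \<open>p\<close> may be any algebraic integer, not just an element of
  Z[\<zeta>]. This is what allows the lemma to be used in determining the ring of integers.\<close>

lemma dvd_poly_if_p_adv:
  assumes "Polynomial.degree f < p - 1" "of_nat p adv ieval f \<zeta>"
  shows "[:int p:] dvd f"
proof (rule dvd_poly_if_lam_power_adv[of "p - 1"])
  show "\<forall>i\<ge>p - 1. poly.coeff f i = 0" using assms(1) by (auto intro: coeff_eq_0)
  show "lam ^ (p - 1) adv ieval f \<zeta>" using adv_trans[OF lam_power_adv_p assms(2)] .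
qed simp

text \<open>Infinite descent: 0 is divisible by \<open>p\<close>, so \<open>f\<close> is
  \<open>p\<close> times a polynomial that also vanishes at \<zeta> and has a smaller leading
  coefficient. This stands in for the irreducibility of the cyclotomic polynomial.\<close>

lemma ieval_zeta_eq_0:
  assumes "Polynomial.degree f < p - 1" "ieval f \<zeta> = 0"
  shows "f = 0"
  using assms
proof (induction "nat \<bar>lead_coeff f\<bar>" arbitrary: f rule: less_induct)
  case less
  show ?case
  proof (rule ccontr)
    assume "f \<noteq> 0"
    have "[:int p:] dvd f" using less.prems by (intro dvd_poly_if_p_adv) simp_all
    then obtain g where "f = [:int p:] * g" by blast
    then have f: "f = Polynomial.smult (int p) g" by simp
    have g: "lead_coeff g \<noteq> 0" "Polynomial.degree g = Polynomial.degree f" "lead_coeff f = int p * lead_coeff g"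
      using \<open>f \<noteq> 0\<close> p_ge_3 by (auto simp: f)
    have "1 * \<bar>lead_coeff g\<bar> < int p * \<bar>lead_coeff g\<bar>"
      using g(1) p_ge_3 by (intro mult_strict_right_mono) auto
    then have "nat \<bar>lead_coeff g\<bar> < nat \<bar>lead_coeff f\<bar>"
      unfolding g(3) by (simp add: abs_mult)
    moreover have "ieval g \<zeta> = 0" using less.prems(2) p_ge_3 by (simp add: f)
    ultimately have "g = 0" using less.hyps[of g] less.prems(1) g(2) by simp
    then show False using g(1) by simp
  qed
qed

text \<open>Reduction modulo \<open>1 + X + ... + X^(p-1)\<close>, which vanishes at every
  nontrivial \<open>p\<close>-th root of unity, so one \<open>g\<close> serves all conjugates at
  once.\<close>

lemma ieval_reduce:
  obtains g where "Polynomial.degree g < p - 1"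
    "\<And>w. w ^ p = 1 \<Longrightarrow> w \<noteq> 1 \<Longrightarrow> ieval f w = ieval g w"
proof -
  have "\<exists>g. Polynomial.degree g < p - 1 \<and> (\<forall>w. w ^ p = 1 \<longrightarrow> w \<noteq> 1 \<longrightarrow> ieval f w = ieval g w)"
  proof (induction f)
    case 0
    show ?case using p_ge_3 by (intro exI[of _ 0]) simp
  next
    case (pCons a f)
    then obtain g where g: "Polynomial.degree g < p - 1"
      "\<And>w. w ^ p = 1 \<Longrightarrow> w \<noteq> 1 \<Longrightarrow> ieval f w = ieval g w" by blast
    define \<Phi> :: "int poly" where "\<Phi> = (\<Sum>i<p. Polynomial.monom 1 i)"
    have \<Phi>: "poly.coeff \<Phi> i = (if i < p then 1 else 0)" for i
      by (simp add: \<Phi>_def coeff_sum)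
    define c where "c = poly.coeff (pCons a g) (p - 1)"
    define g' where "g' = pCons a g - Polynomial.smult c \<Phi>"
    have "Polynomial.degree (pCons a g) \<le> p - 1"
      using g(1) by (intro order_trans[OF degree_pCons_le]) simp
    then have "poly.coeff g' i = 0" if "i \<ge> p - 1" for i
      using that p_ge_3 by (cases "i = p - 1") (auto simp: g'_def \<Phi> c_def coeff_eq_0)
    then have "Polynomial.degree g' < p - 1"
      using p_ge_3 by (intro degree_lessI) auto
    moreover have "ieval (pCons a f) w = ieval g' w" if "w ^ p = 1" "w \<noteq> 1" for w
      using g(2)[OF that] sum_root_powers[OF that] by (simp add: g'_def \<Phi>_def)
    ultimately show ?case by blast
  qed
  then show thesis using that by blast
qed

text \<open>This makes the conjugation sending \<zeta> to \<open>w\<close> well defined on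
  Z[\<zeta>]: every integer polynomial relation for \<zeta> transfers to \<open>w\<close>.\<close>

lemma ieval_conjugate_eq_0:
  assumes "ieval f \<zeta> = 0" "w ^ p = 1" "w \<noteq> 1"
  shows "ieval f w = 0"
proof -
  obtain g where g: "Polynomial.degree g < p - 1"
    "\<And>w. w ^ p = 1 \<Longrightarrow> w \<noteq> 1 \<Longrightarrow> ieval f w = ieval g w"
    using ieval_reduce[of f] by blast
  have "g = 0" using g(2)[of \<zeta>] assms(1) zeta_neq_1 by (intro ieval_zeta_eq_0 g(1)) simp
  then show ?thesis using g(2)[OF assms(2,3)] by simp
qed

section \<open>The trace formula and the ring of integers\<close>

lemma sum_zeta_powers: "(\<Sum>j<p. \<zeta> ^ (m * j)) = (if p dvd m then of_nat p else 0)"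
proof (cases "p dvd m")
  case True
  then have "\<zeta> ^ (m * j) = 1" for j using zeta_power_eq_1_iff by simp
  then show ?thesis using True by simp
next
  case False
  then have "(\<Sum>j<p. (\<zeta> ^ m) ^ j) = 0"
    using zeta_power_eq_1_iff by (intro sum_root_powers) simp_all
  then show ?thesis using False by (simp add: power_mult)
qed

text \<open>Orthogonality of characters; the left side is the trace of (\<zeta>^(-k) - \<zeta>)
  f(\<zeta>), with \<open>p - k\<close> in place of \<open>-k\<close>. Subtracting \<zeta>^j makes
  the term \<open>j = 0\<close>, which is not a conjugate, vanish, and it contributes nothing else
  since \<open>f\<close> has no coefficient at \<open>p - 1\<close>.\<close>

lemma coeff_as_trace:
  assumes f: "Polynomial.degree f < p - 1" and k: "k < p - 1"
  shows "(\<Sum>j<p. (\<zeta> ^ ((p - k) * j) - \<zeta> ^ j) * ieval f (\<zeta> ^ j)) = of_nat p * of_int (poly.coeff f k)"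
proof -
  let ?c = "\<lambda>i. of_int (poly.coeff f i) :: complex"
  have "(\<Sum>j<p. (\<zeta> ^ ((p - k) * j) - \<zeta> ^ j) * ieval f (\<zeta> ^ j))
      = (\<Sum>j<p. \<Sum>i<p-1. ?c i * (\<zeta> ^ ((p - k + i) * j) - \<zeta> ^ ((1 + i) * j)))"
    unfolding ieval_altdef[OF f] sum_distrib_left
    by (intro sum.cong refl) (simp add: algebra_simps power_add power_mult flip: power_mult)
  also have "\<dots> = (\<Sum>i<p-1. \<Sum>j<p. ?c i * (\<zeta> ^ ((p - k + i) * j) - \<zeta> ^ ((1 + i) * j)))"
    by (rule sum.swap)
  also have "\<dots> = (\<Sum>i<p-1. if i = k then ?c i * of_nat p else 0)"
  proof (rule sum.cong)
    fix i assume i: "i \<in> {..<p-1}"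
    have "p dvd p - k + i \<longleftrightarrow> i = k"
    proof
      assume "p dvd p - k + i"
      then obtain q where q: "p - k + i = p * q" by blast
      have "0 < p * q" "p * q < p * 2" unfolding q[symmetric] using i k by auto
      then have "q = 1" by simp
      then show "i = k" using q k by simp
    qed (use k in simp)
    moreover have "\<not> p dvd 1 + i" using i by (auto dest: dvd_imp_le)
    ultimately show "(\<Sum>j<p. ?c i * (\<zeta> ^ ((p - k + i) * j) - \<zeta> ^ ((1 + i) * j)))
        = (if i = k then ?c i * of_nat p else 0)"
      unfolding sum_distrib_left[symmetric] sum_subtractf sum_zeta_powers by simp
  qed simp
  also have "\<dots> = of_nat p * ?c k" using k by (simp add: mult.commute)
  finally show ?thesis .
qed

lemma algebraic_int_conjugate:
  assumes x: "algebraic_int x" "N \<noteq> 0" "of_int N * x = ieval f \<zeta>" and w: "w ^ p = 1" "w \<noteq> 1"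
  shows "algebraic_int (ieval f w / of_int N)"
proof -
  obtain q where q: "ieval q x = 0" "lead_coeff q = 1"
    using x(1) unfolding algebraic_int_iff_ieval by blast
  define d where "d = Polynomial.degree q"
  \<comment> \<open>This is \<open>N^d * q(f / N)\<close> with denominators cleared; as an integer
    polynomial vanishing at \<zeta> it also vanishes at \<open>w\<close>.\<close>
  define g where "g = (\<Sum>i<Suc d. Polynomial.smult (poly.coeff q i * N ^ (d - i)) (f ^ i))"
  have g: "ieval g y = of_int N ^ d * ieval q (ieval f y / of_int N)" for y
  proof -
    have eq: "of_int (poly.coeff q i * N ^ (d - i)) * ieval f y ^ i
        = of_int N ^ d * (of_int (poly.coeff q i) * (ieval f y / of_int N) ^ i)" if "i < Suc d" for i
    proof -
      have "of_int N ^ d = of_int N ^ (d - i) * (of_int N ^ i :: complex)"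
        using that by (simp flip: power_add)
      then show ?thesis using x(2) by (simp add: power_divide)
    qed
    have q_eq: "ieval q (ieval f y / of_int N)
        = (\<Sum>i<Suc d. of_int (poly.coeff q i) * (ieval f y / of_int N) ^ i)"
      by (rule ieval_altdef) (simp add: d_def)
    show ?thesis
      unfolding g_def q_eq ieval_sum ieval_smult ieval_power sum_distrib_left
      by (intro sum.cong refl eq) simp
  qed
  have "ieval f \<zeta> / of_int N = x" using x(2) by (simp flip: x(3))
  then have "ieval g \<zeta> = 0" unfolding g using q(1) by simp
  then have "ieval g w = 0" using ieval_conjugate_eq_0 w by blast
  then have "ieval q (ieval f w / of_int N) = 0" unfolding g using x(2) by simp
  then show ?thesis using q(2) algebraic_int_iff_ieval by blast
qed

text \<open>The trace formula, divided by \<open>N\<close>, is a rational algebraic integer. Hence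
  \<open>N\<close> divides \<open>p\<close> times each coefficient and \<open>p * x\<close> lies in
  Z[\<zeta>]. The remaining factor \<open>p\<close> is removed by
  \<open>dvd_poly_if_p_adv\<close>.\<close>

theorem algebraic_int_imp_int_poly:
  assumes x: "algebraic_int x" "N \<noteq> 0" "of_int N * x = ieval f \<zeta>"
  obtains g where "Polynomial.degree g < p - 1" "x = ieval g \<zeta>"
proof -
  obtain f' where f': "Polynomial.degree f' < p - 1"
    "\<And>w. w ^ p = 1 \<Longrightarrow> w \<noteq> 1 \<Longrightarrow> ieval f w = ieval f' w"
    using ieval_reduce[of f] by blast
  have x3: "of_int N * x = ieval f' \<zeta>" using x(3) f'(2)[of \<zeta>] zeta_neq_1 by simp
  have "N dvd int p * poly.coeff f' k" for k
  proof (cases "k < p - 1")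
    case True
    have "algebraic_int ((\<Sum>j<p. (\<zeta> ^ ((p - k) * j) - \<zeta> ^ j) * (ieval f' (\<zeta> ^ j) / of_int N)))"
    proof (rule algebraic_int_sum_complex)
      fix j assume j: "j \<in> {..<p}"
      show "algebraic_int ((\<zeta> ^ ((p - k) * j) - \<zeta> ^ j) * (ieval f' (\<zeta> ^ j) / of_int N))"
      proof (cases "j = 0")
        case False
        then have "\<zeta> ^ j \<noteq> 1" using j zeta_power_eq_1_iff by (auto dest: dvd_imp_le)
        then have "algebraic_int (ieval f' (\<zeta> ^ j) / of_int N)"
          by (intro algebraic_int_conjugate[OF x(1,2) x3]) simp_all
        then show ?thesis
          by (intro algebraic_int_times_complex algebraic_int_diff_complex) simp_all
      qed simp
    qed
    also have "(\<Sum>j<p. (\<zeta> ^ ((p - k) * j) - \<zeta> ^ j) * (ieval f' (\<zeta> ^ j) / of_int N))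
        = of_nat p * of_int (poly.coeff f' k) / of_int N"
      unfolding coeff_as_trace[OF f'(1) True, symmetric] sum_divide_distrib by simp
    finally have "of_nat p * of_int (poly.coeff f' k) / of_int N \<in> (\<int> :: complex set)"
      by (rule rational_algebraic_int_is_int) simp
    then obtain m where "of_nat p * of_int (poly.coeff f' k) / of_int N = (of_int m :: complex)"
      by (elim Ints_cases)
    then have "of_int (int p * poly.coeff f' k) = (of_int (m * N) :: complex)"
      using x(2) by (simp add: field_simps)
    then have "int p * poly.coeff f' k = m * N" by (simp only: of_int_eq_iff)
    then show ?thesis by simp
  next
    case False
    then have "poly.coeff f' k = 0" using f'(1) by (intro coeff_eq_0) simp
    then show ?thesis by simp
  qed
  then have "[:N:] dvd Polynomial.smult (int p) f'" unfolding const_poly_dvd_iff by simp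
  then obtain h where "Polynomial.smult (int p) f' = [:N:] * h" by blast
  then have h: "Polynomial.smult (int p) f' = Polynomial.smult N h" by simp
  have "Polynomial.degree (Polynomial.smult (int p) f') = Polynomial.degree (Polynomial.smult N h)"
    by (simp only: h)
  then have deg_h: "Polynomial.degree h < p - 1" using f'(1) x(2) p_ge_3 by simp
  have "of_int N * (of_nat p * x) = ieval (Polynomial.smult (int p) f') \<zeta>"
    using x3 by (simp add: mult_ac)
  then have "of_int N * (of_nat p * x) = of_int N * ieval h \<zeta>" unfolding h by simp
  then have px: "of_nat p * x = ieval h \<zeta>" using x(2) by simp
  have "[:int p:] dvd h"
    using deg_h advI[OF x(1), of "of_nat p"] unfolding px by (rule dvd_poly_if_p_adv)
  then obtain g where "h = [:int p:] * g" by blast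
  then have g: "h = Polynomial.smult (int p) g" by simp
  have "Polynomial.degree g < p - 1" using deg_h p_ge_3 by (simp add: g)
  moreover have "x = ieval g \<zeta>" using px p_ge_3 by (simp add: g)
  ultimately show thesis by (rule that)
qed

section \<open>The field Q(\<zeta>) as quotients of elements of Z[\<zeta>] by integers\<close>

definition cyclo_field :: "complex set" where
  "cyclo_field = {x. \<exists>N f. N \<noteq> 0 \<and> of_int N * x = ieval f \<zeta>}"

lemma cyclo_field_I: "N \<noteq> 0 \<Longrightarrow> of_int N * x = ieval f \<zeta> \<Longrightarrow> x \<in> cyclo_field"
  unfolding cyclo_field_def by blast

lemma ieval_in_cyclo_field: "ieval f \<zeta> \<in> cyclo_field"
  by (rule cyclo_field_I[of 1 _ f]) simp_all

lemma cyclo_field_closed: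
  assumes "x \<in> cyclo_field" "y \<in> cyclo_field"
  shows "x - y \<in> cyclo_field" "x + y \<in> cyclo_field" "x * y \<in> cyclo_field"
proof -
  obtain M N f g where M: "M \<noteq> 0" "of_int M * x = ieval f \<zeta>" and N: "N \<noteq> 0" "of_int N * y = ieval g \<zeta>"
    using assms unfolding cyclo_field_def by blast
  have MN: "M * N \<noteq> 0" using M N by simp
  have eqs: "of_int (M * N) * (x - y) = ieval (Polynomial.smult N f - Polynomial.smult M g) \<zeta>"
    "of_int (M * N) * (x + y) = ieval (Polynomial.smult N f + Polynomial.smult M g) \<zeta>"
    "of_int (M * N) * (x * y) = ieval (f * g) \<zeta>"
    by (simp_all add: algebra_simps flip: M(2) N(2))
  show "x - y \<in> cyclo_field" "x + y \<in> cyclo_field" "x * y \<in> cyclo_field"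
    using cyclo_field_I[OF MN eqs(1)] cyclo_field_I[OF MN eqs(2)] cyclo_field_I[OF MN eqs(3)] by blast+
qed

text \<open>This provides inverses: after vanishing constant terms are stripped off, the equation
  for \<open>y\<close> reads \<open>y * r(y) = m\<close> with an integer \<open>m\<close> different
  from 0.\<close>

lemma algebraic_int_dvd_int:
  assumes "q \<noteq> 0" "ieval q y = 0" "y \<noteq> 0"
  shows "\<exists>r m. m \<noteq> 0 \<and> y * ieval r y = of_int m"
  using assms(1,2)
proof (induction q)
  case (pCons a q)
  show ?case
  proof (cases "a = 0")
    case True
    then show ?thesis using pCons assms(3) by auto
  next
    case False
    then show ?thesis
      using pCons.prems by (intro exI[of _ q] exI[of _ "- a"]) (simp add: add_eq_0_iff)
  qed
qed simp

lemma cyclo_field_inverse: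
  assumes "x \<in> cyclo_field"
  shows "inverse x \<in> cyclo_field"
proof (cases "x = 0")
  case False
  obtain N f where N: "N \<noteq> 0" "of_int N * x = ieval f \<zeta>" using assms unfolding cyclo_field_def by blast
  define y where "y = ieval f \<zeta>"
  have "algebraic_int y" unfolding y_def by (simp add: algebraic_int_ieval)
  then obtain q where q: "ieval q y = 0" "lead_coeff q = 1" unfolding algebraic_int_iff_ieval by blast
  have "y \<noteq> 0" using N False unfolding y_def by (metis mult_eq_0_iff of_int_eq_0_iff)
  then obtain r m where rm: "m \<noteq> 0" "y * ieval r y = of_int m"
    using algebraic_int_dvd_int[of q y] q by force
  have "of_int m * inverse x = ieval (Polynomial.smult N (pcompose r f)) \<zeta>"
    using False by (simp flip: rm(2) y_def) (simp add: y_def flip: N(2))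
  then show ?thesis using cyclo_field_I[OF rm(1)] by blast
qed (use assms in simp)

lemma rat_adjoin_zeta: "rat_adjoin \<zeta> = ring_of_type_algebra\<lparr>carrier := cyclo_field\<rparr>"
proof -
  let ?C = "ring_of_type_algebra :: complex ring"
  let ?H = "insert \<zeta> \<rat>"
  have C: "x \<otimes>\<^bsub>?C\<^esub> y = x * y" "x \<oplus>\<^bsub>?C\<^esub> y = x + y" "\<one>\<^bsub>?C\<^esub> = 1" "\<zero>\<^bsub>?C\<^esub> = 0" "carrier ?C = UNIV" for x y
    by (simp_all add: ring_of_type_algebra_def)
  have a_inv: "\<ominus>\<^bsub>?C\<^esub> x = - x" for x
    unfolding a_inv_def m_inv_def
    by (rule the_equality) (simp_all add: C eq_neg_iff_add_eq_0 add.commute)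
  have m_inv: "inv\<^bsub>?C\<^esub> x = inverse x" if "x \<noteq> 0" for x
    unfolding m_inv_def
    by (rule the_equality) (use that in \<open>auto simp: C dest: inverse_unique\<close>)
  have "generate_field ?C ?H = cyclo_field"
  proof
    show "generate_field ?C ?H \<subseteq> cyclo_field"
    proof
      fix x assume "x \<in> generate_field ?C ?H"
      then show "x \<in> cyclo_field"
      proof (induction rule: generate_field.induct)
        case one
        show ?case using ieval_in_cyclo_field[of 1] by (simp add: C)
      next
        case (incl h)
        show ?case
        proof (cases "h = \<zeta>")
          case True
          then show ?thesis using ieval_in_cyclo_field[of "[:0, 1:]"] by simp
        next
          case False
          then have "h \<in> \<rat>" using incl by simp
          then obtain a b where ab: "b > 0" "h = of_int a / of_int b" by (elim Rats_cases')
          then show ?thesis by (intro cyclo_field_I[of b _ "[:a:]"]) simp_all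
        qed
      next
        case (a_inv h)
        have "0 \<in> cyclo_field" using ieval_in_cyclo_field[of 0] by simp
        then show ?case using cyclo_field_closed(1)[of 0 h] a_inv by (simp add: \<open>\<And>x. \<ominus>\<^bsub>?C\<^esub> x = - x\<close>)
      next
        case (m_inv h)
        then show ?case using cyclo_field_inverse \<open>\<And>x. x \<noteq> 0 \<Longrightarrow> inv\<^bsub>?C\<^esub> x = inverse x\<close> by (simp add: C)
      qed (simp_all add: C cyclo_field_closed)
    qed
    show "cyclo_field \<subseteq> generate_field ?C ?H"
    proof
      fix x assume "x \<in> cyclo_field"
      then obtain N f where N: "N \<noteq> 0" "of_int N * x = ieval f \<zeta>" unfolding cyclo_field_def by blast
      have rat: "q \<in> generate_field ?C ?H" if "q \<in> \<rat>" for q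
        using that by (intro generate_field.incl) simp
      have zeta: "\<zeta> \<in> generate_field ?C ?H" by (intro generate_field.incl) simp
      have add: "a + b \<in> generate_field ?C ?H" and mult: "a * b \<in> generate_field ?C ?H"
        if "a \<in> generate_field ?C ?H" "b \<in> generate_field ?C ?H" for a b
        using generate_field.eng_add[OF that] generate_field.eng_mult[OF that] by (simp_all add: C)
      have "ieval f \<zeta> \<in> generate_field ?C ?H"
        by (induction f) (simp_all add: rat zeta add mult)
      then have "inverse (of_int N) * ieval f \<zeta> \<in> generate_field ?C ?H"
        using mult[OF rat[of "inverse (of_int N)"]] by simp
      moreover have "x = inverse (of_int N) * ieval f \<zeta>"
        using N(1) by (simp flip: N(2))
      ultimately show "x \<in> generate_field ?C ?H" by simp
    qed
  qed
  then show ?thesis unfolding rat_adjoin_def by simp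
qed

abbreviation \<O> :: "complex set" where
  "\<O> \<equiv> ring_of_integers (rat_adjoin \<zeta>)"

lemma mem_O: "x \<in> \<O> \<longleftrightarrow> x \<in> cyclo_field \<and> algebraic_int x"
  unfolding ring_of_integers_def rat_adjoin_zeta by (simp add: ring_of_type_algebra_def)

lemma ieval_in_O: "ieval f \<zeta> \<in> \<O>"
  unfolding mem_O by (simp add: ieval_in_cyclo_field algebraic_int_ieval)

lemma O_cases:
  assumes "x \<in> \<O>"
  obtains g where "Polynomial.degree g < p - 1" "x = ieval g \<zeta>"
  using assms algebraic_int_imp_int_poly unfolding mem_O cyclo_field_def by blast

sublocale number_ring cyclo_field "(\<lambda>i. \<zeta> ^ i) ` {..<p-1}" "rat_adjoin \<zeta>" \<O>
proof
  show "1 \<in> cyclo_field" using ieval_in_cyclo_field[of 1] by simp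
  show "\<exists>d\<in>\<O>. d \<noteq> 0 \<and> d * x \<in> \<O>" if x: "x \<in> cyclo_field" for x
  proof -
    obtain N f where N: "N \<noteq> 0" "of_int N * x = ieval f \<zeta>" using x unfolding cyclo_field_def by blast
    have "of_int N \<in> \<O>" using ieval_in_O[of "[:N:]"] by simp
    moreover have "of_int N * x \<in> \<O>" unfolding N(2) by (rule ieval_in_O)
    moreover have "of_int N \<noteq> (0 :: complex)" using N(1) by simp
    ultimately show ?thesis by blast
  qed
  show "\<O> \<subseteq> zmod.span ((\<lambda>i. \<zeta> ^ i) ` {..<p-1})"
  proof
    fix x assume "x \<in> \<O>"
    then obtain g where g: "Polynomial.degree g < p - 1" "x = ieval g \<zeta>" by (rule O_cases)
    show "x \<in> zmod.span ((\<lambda>i. \<zeta> ^ i) ` {..<p-1})"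
      unfolding g(2) ieval_altdef[OF g(1)]
      by (intro zmod.span_sum zmod.span_scale zmod.span_base) blast
  qed
qed (simp_all add: rat_adjoin_zeta cyclo_field_closed cyclo_field_inverse)

end

context prime_cyclotomic
begin

subsection \<open>Units\<close>

lemma cnj_root_of_unity:
  assumes "w ^ p = 1"
  shows "cnj w = w ^ (p - 1)"
proof -
  obtain k where "w = \<zeta> ^ k" using root_of_unity_cases[OF assms] by blast
  then have "norm w = 1" by (simp add: zeta_power)
  then have "w * cnj w = 1" by (simp flip: complex_norm_square)
  moreover have "w * w ^ (p - 1) = 1"
    using assms by (simp flip: power_Suc)
  moreover have "w \<noteq> 0" using calculation(1) by auto
  ultimately show ?thesis by (metis mult_left_cancel)
qed

text \<open>All powers of \<zeta> are 1 modulo \<open>lam\<close>, so every conjugate of an element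
  has the same integer residue \<open>f(1)\<close>.\<close>

lemma lam_adv_ieval_diff: "lam adv ieval f (\<zeta> ^ j) - of_int (poly f 1)"
proof (induction f)
  case (pCons a f)
  have "lam adv \<zeta> ^ j * (ieval f (\<zeta> ^ j) - of_int (poly f 1)) - (1 - \<zeta> ^ j) * of_int (poly f 1)"
    by (intro adv_diff adv_mult_left adv_mult_right pCons.IH lam_adv_one_minus) simp_all
  then show ?case by (simp add: algebra_simps)
qed simp

lemma finite_bounded_polys:
  assumes "finite C"
  shows "finite {f :: int poly. Polynomial.degree f < m \<and> (\<forall>i. poly.coeff f i \<in> C)}"
proof (rule finite_subset)
  show "{f. Polynomial.degree f < m \<and> (\<forall>i. poly.coeff f i \<in> C)} \<subseteq> Poly ` {xs. set xs \<subseteq> C \<and> length xs = m}"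
  proof
    fix f assume "f \<in> {f. Polynomial.degree f < m \<and> (\<forall>i. poly.coeff f i \<in> C)}"
    then have f: "Polynomial.degree f < m" "\<And>i. poly.coeff f i \<in> C" by simp_all
    have "f = Poly (map (poly.coeff f) [0..<m])"
      by (rule poly_eqI) (use f(1) in \<open>auto simp: coeff_Poly_eq nth_default_def intro!: coeff_eq_0\<close>)
    moreover have "map (poly.coeff f) [0..<m] \<in> {xs. set xs \<subseteq> C \<and> length xs = m}"
      using f(2) by auto
    ultimately show "f \<in> Poly ` {xs. set xs \<subseteq> C \<and> length xs = m}" by blast
  qed
  show "finite (Poly ` {xs. set xs \<subseteq> C \<and> length xs = m})"
    using finite_lists_length_eq[OF assms] by blast
qed

text \<open>In the trace formula each of the \<open>p\<close> terms has absolute value at most 2,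
  the bound for a difference of two roots of unity. Where \<zeta>^j = 1 nothing is known about
  \<open>f\<close>, but there the difference is 0.\<close>

lemma coeff_bound:
  assumes f: "Polynomial.degree f < p - 1" and norm: "\<And>w. w ^ p = 1 \<Longrightarrow> w \<noteq> 1 \<Longrightarrow> norm (ieval f w) = 1"
  shows "\<bar>poly.coeff f k\<bar> \<le> 2"
proof (cases "k < p - 1")
  case True
  have "norm ((\<zeta> ^ ((p - k) * j) - \<zeta> ^ j) * ieval f (\<zeta> ^ j)) \<le> 2" for j
  proof (cases "\<zeta> ^ j = 1")
    case j: True
    have "\<zeta> ^ ((p - k) * j) = (\<zeta> ^ j) ^ (p - k)" by (simp add: mult.commute power_mult)
    then show ?thesis by (simp add: j)
  next
    case False
    have one: "norm (\<zeta> ^ i) = 1" for i by (simp add: zeta_power)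
    have "norm (\<zeta> ^ ((p - k) * j) - \<zeta> ^ j) \<le> norm (\<zeta> ^ ((p - k) * j)) + norm (\<zeta> ^ j)"
      by (rule norm_triangle_ineq4)
    also have "\<dots> = 2" by (simp only: one)
    finally show ?thesis using norm[OF _ False] by (simp add: norm_mult)
  qed
  then have "norm (\<Sum>j<p. (\<zeta> ^ ((p - k) * j) - \<zeta> ^ j) * ieval f (\<zeta> ^ j)) \<le> (\<Sum>j<p. 2)"
    by (intro sum_norm_le)
  then have "real p * real_of_int \<bar>poly.coeff f k\<bar> \<le> real p * 2"
    unfolding coeff_as_trace[OF f True] by (simp add: norm_mult)
  then show ?thesis by simp
next
  case False
  then show ?thesis using f by (simp add: coeff_eq_0)
qed

text \<open>Kronecker: the powers lie in the finite set of integers with bounded coordinates.\<close>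
lemma root_of_unity_if_norm_1:
  assumes norm: "\<And>w. w ^ p = 1 \<Longrightarrow> w \<noteq> 1 \<Longrightarrow> norm (ieval g w) = 1"
  obtains n where "n > 0" "ieval g \<zeta> ^ n = 1"
proof -
  define v where "v = ieval g \<zeta>"
  define S where "S = {f :: int poly. Polynomial.degree f < p - 1 \<and> (\<forall>i. poly.coeff f i \<in> {-2..2})}"
  have "finite S" unfolding S_def by (rule finite_bounded_polys) simp
  have "v ^ n \<in> (\<lambda>f. ieval f \<zeta>) ` S" for n
  proof -
    obtain h where h: "Polynomial.degree h < p - 1"
      "\<And>w. w ^ p = 1 \<Longrightarrow> w \<noteq> 1 \<Longrightarrow> ieval (g ^ n) w = ieval h w"
      using ieval_reduce[of "g ^ n"] by blast
    have "norm (ieval h w) = 1" if "w ^ p = 1" "w \<noteq> 1" for w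
      using h(2)[OF that] norm[OF that] by (simp add: norm_power flip: h(2)[OF that])
    then have "\<bar>poly.coeff h i\<bar> \<le> 2" for i by (rule coeff_bound[OF h(1)])
    then have "h \<in> S" unfolding S_def using h(1) by (auto simp: abs_le_iff minus_le_iff)
    moreover have "v ^ n = ieval h \<zeta>" using h(2)[of \<zeta>] zeta_neq_1 by (simp add: v_def)
    ultimately show ?thesis by blast
  qed
  then have "range (\<lambda>n. v ^ n) \<subseteq> (\<lambda>f. ieval f \<zeta>) ` S" by blast
  then have "finite (range (\<lambda>n. v ^ n))" using \<open>finite S\<close> finite_subset by blast
  then have "\<not> inj (\<lambda>n. v ^ n)" using finite_imageD infinite_UNIV_nat by blast
  then obtain i j where ij: "i < j" "v ^ i = v ^ j"
    unfolding inj_def by (metis linorder_neqE_nat)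
  have "v \<noteq> 0" using norm[of \<zeta>] zeta_neq_1 by (auto simp: v_def)
  have "v ^ i * v ^ (j - i) = v ^ j" using ij(1) by (simp flip: power_add)
  then have "v ^ (j - i) = 1" using \<open>v \<noteq> 0\<close> by (simp flip: ij(2))
  then show thesis using that[of "j - i"] ij(1) by (simp add: v_def)
qed

lemma lam_adv_power_minus_1:
  assumes "lam adv v - 1" "algebraic_int v"
  shows "lam adv v ^ n - 1"
proof -
  have "1 - v adv 1 - v ^ n" by (rule adv_one_minus_power[OF assms(2)])
  moreover have "lam adv 1 - v" using adv_uminus[OF assms(1)] by simp
  ultimately have "lam adv 1 - v ^ n" using adv_trans by blast
  then show ?thesis using adv_uminus[of lam "1 - v ^ n"] by simp
qed

text \<open>Otherwise \<open>1 + v + ... + v^(n-1) = 0\<close>; but this sum is \<open>n\<close>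
  modulo \<open>lam\<close>.\<close>

lemma eq_1_if_power_eq_1:
  assumes v: "lam adv v - 1" "algebraic_int v" and n: "v ^ n = 1" "\<not> p dvd n"
  shows "v = 1"
proof (rule ccontr)
  assume "v \<noteq> 1"
  then have "(\<Sum>i<n. v ^ i) = 0" using n(1) by (simp add: sum_gp_strict)
  moreover have "lam adv (\<Sum>i<n. v ^ i - 1)"
    by (intro adv_sum lam_adv_power_minus_1 v)
  ultimately have "lam adv - of_nat n" by (simp add: sum_subtractf)
  then have "lam adv of_int (int n)" using adv_uminus[of lam "- of_nat n"] by simp
  then show False using n(2) unfolding lam_adv_int_iff by simp
qed

lemma lam_power_p_adv:
  assumes "lam adv x - 1"
  shows "lam ^ p adv x ^ p - 1"
proof -
  have "(\<Prod>k<p. lam) adv (\<Prod>k<p. x - \<zeta> ^ k)"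
  proof (rule adv_prod_mono)
    show "lam adv x - \<zeta> ^ k" for k
      using adv_add[OF assms lam_adv_one_minus[of k]] by simp
  qed
  then show ?thesis unfolding prod_x_minus_zeta by simp
qed

text \<open>The exponent is lowered as long as \<open>p\<close> divides it. The obstacle would be an
  order divisible by \<open>p^2\<close>: then some \<zeta>^s other than 1 would be a
  \<open>p\<close>-th power of an element that is 1 modulo \<open>lam\<close>, hence 1 modulo
  \<open>lam^p\<close>, whereas 1 - \<zeta>^s is an associate of \<open>lam\<close>.\<close>

lemma power_p_eq_1:
  assumes v: "lam adv v - 1" "algebraic_int v" and n: "n > 0" "v ^ n = 1"
  shows "v ^ p = 1"
  using n
proof (induction n rule: less_induct)
  case (less n)
  show ?case
  proof (cases "p dvd n")
    case False
    then have "v = 1" using eq_1_if_power_eq_1[OF v less.prems(2)] by simp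
    then show ?thesis by simp
  next
    case True
    then obtain m where m: "n = p * m" by blast
    have m_pos: "m > 0" "m < n" using less.prems(1) p_ge_3 by (auto simp: m)
    have "(v ^ m) ^ p = 1" using less.prems(2) by (simp add: m mult.commute power_mult)
    then obtain s where s: "v ^ m = \<zeta> ^ s" by (rule root_of_unity_cases)
    show ?thesis
    proof (cases "p dvd s")
      case True
      then have "v ^ m = 1" using s zeta_power_eq_1_iff by simp
      then show ?thesis using less.IH[of m] m_pos by blast
    next
      case False
      have "\<not> p dvd m"
      proof
        assume "p dvd m"
        then obtain l where l: "m = l * p" by (metis dvd_def mult.commute)
        have "lam ^ p adv (v ^ l) ^ p - 1"
          by (intro lam_power_p_adv lam_adv_power_minus_1 v)
        also have "(v ^ l) ^ p = \<zeta> ^ s" using s unfolding l by (simp add: power_mult)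
        finally have "lam ^ p adv 1 - \<zeta> ^ s" using adv_uminus[of "lam ^ p" "\<zeta> ^ s - 1"] by simp
        then have "lam ^ p adv lam" using one_minus_adv_lam[OF False] adv_trans by blast
        then have "lam * lam ^ (p - 1) adv lam * 1" by (simp flip: power_Suc)
        then have "lam ^ (p - 1) adv 1" by (rule adv_cancel[OF lam_neq_0])
        then show False
          using adv_trans[OF lam_power_adv_lam_power[of 1 "p - 1"]] p_ge_3 not_lam_adv_1 by simp
      qed
      moreover have "(v ^ p) ^ m = 1" using less.prems(2) by (simp add: m power_mult)
      ultimately show ?thesis
        using eq_1_if_power_eq_1[of "v ^ p" m] lam_adv_power_minus_1[OF v] algebraic_int_power_complex[OF v(2)]
        by blast
    qed
  qed
qed

theorem unit_eq_root_of_unity_times_cnj: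
  assumes u: "u \<in> \<O>" "inverse u \<in> \<O>" "u \<noteq> 0"
  obtains k where "k < p" "u = \<zeta> ^ k * cnj u"
proof -
  obtain f where f: "u = ieval f \<zeta>" using O_cases[OF u(1)] by blast
  obtain f' where f': "inverse u = ieval f' \<zeta>" using O_cases[OF u(2)] by blast
  \<comment> \<open>Substituting \<open>X^(p-1)\<close> for \<open>X\<close> is complex conjugation
    at every \<open>p\<close>-th root of unity simultaneously. So \<open>g\<close> below represents
    \<open>u * cnj (inverse u)\<close> compatibly with all conjugates.\<close>
  define conj where "conj h = pcompose h (Polynomial.monom 1 (p - 1))" for h :: "int poly"
  have conj: "ieval (conj h) w = cnj (ieval h w)" if "w ^ p = 1" for h w
    unfolding conj_def by (simp add: cnj_ieval cnj_root_of_unity[OF that])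
  define g where "g = f * conj f'"
  have g: "ieval g w = ieval f w * cnj (ieval f' w)" if "w ^ p = 1" for w
    unfolding g_def using conj[OF that] by simp
  have "norm (ieval g w) = 1" if w: "w ^ p = 1" "w \<noteq> 1" for w
  proof -
    \<comment> \<open>The relation \<open>u * inverse u = 1\<close> passes to each conjugate, so the
      absolute values of \<open>f(w)\<close> and \<open>f'(w)\<close> are reciprocal.\<close>
    have "ieval (f * f' - 1) \<zeta> = 0" using u(3) by (simp flip: f f')
    then have "ieval (f * f' - 1) w = 0" using ieval_conjugate_eq_0 w by blast
    then have "ieval f w * ieval f' w = 1" by simp
    then have "norm (ieval f w * ieval f' w) = 1" by simp
    then show ?thesis unfolding g[OF w(1)] by (simp add: norm_mult)
  qed
  then obtain n where n: "n > 0" "ieval g \<zeta> ^ n = 1" by (rule root_of_unity_if_norm_1)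
  define v where "v = ieval g \<zeta>"
  have v: "v = u * cnj (inverse u)" by (simp only: v_def g[OF zeta_power_p] f' flip: f)
  \<comment> \<open>The same integer \<open>f(1)\<close> is the residue of \<open>u\<close> and of
    its complex conjugate.\<close>
  have "lam adv (u - of_int (poly f 1)) - (cnj u - of_int (poly f 1))"
  proof (rule adv_diff)
    show "lam adv u - of_int (poly f 1)" using lam_adv_ieval_diff[of f 1] by (simp add: f)
    show "lam adv cnj u - of_int (poly f 1)"
      using lam_adv_ieval_diff[of f "p - 1"] by (simp add: f cnj_ieval cnj_root_of_unity)
  qed
  then have "lam adv (u - cnj u) * cnj (inverse u)"
    using u(2) mem_O algebraic_int_cnj by (intro adv_mult_right) (simp, blast)
  then have "lam adv v - 1" unfolding v using u(3) by (simp add: algebra_simps)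
  moreover have "algebraic_int v" unfolding v_def by (simp add: algebraic_int_ieval)
  ultimately have "v ^ p = 1" using power_p_eq_1 n unfolding v_def by blast
  then obtain k where k: "k < p" "v = \<zeta> ^ k" by (rule root_of_unity_cases)
  have "u = v * cnj u" unfolding v using u(3) by simp
  then show thesis using that k by blast
qed

end

context prime_cyclotomic
begin

subsection \<open>Congruences modulo \<open>p\<close>\<close>

lemma p_adv_freshman:
  assumes "algebraic_int x" "algebraic_int y"
  shows "of_nat p adv (x + y) ^ p - (x ^ p + y ^ p)"
proof -
  have "{..p} = insert 0 (insert p {1..<p})" using p_ge_3 by auto
  then have "(x + y) ^ p - (x ^ p + y ^ p) = (\<Sum>k=1..<p. of_nat (p choose k) * x ^ k * y ^ (p - k))"
    unfolding binomial_ring by simp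
  also have "of_nat p adv \<dots>"
  proof (rule adv_sum)
    fix k assume k: "k \<in> {1..<p}"
    then have "p dvd p choose k" using prime_p by (intro dvd_choose_prime) auto
    then obtain m where m: "p choose k = p * m" by blast
    have "of_nat (p choose k) * x ^ k * y ^ (p - k) = of_nat p * (of_nat m * x ^ k * y ^ (p - k))"
      unfolding m by (simp add: mult.assoc)
    then show "of_nat p adv of_nat (p choose k) * x ^ k * y ^ (p - k)"
      using assms by (simp only:) (intro advI algebraic_int_times_complex algebraic_int_power_complex algebraic_int_of_nat)
  qed
  finally show ?thesis .
qed

text \<open>Modulo \<open>p\<close> the \<open>p\<close>-th power is additive, and it sends \<zeta>
  to 1.\<close>

lemma ieval_power_p_cong_int: "\<exists>n. of_nat p adv ieval f \<zeta> ^ p - of_int n"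
proof (induction f)
  case 0
  show ?case by (intro exI[of _ 0]) (simp add: zero_power)
next
  case (pCons a f)
  then obtain n where n: "of_nat p adv ieval f \<zeta> ^ p - of_int n" by blast
  have "of_nat p adv (of_int a + \<zeta> * ieval f \<zeta>) ^ p - (of_int a ^ p + (\<zeta> * ieval f \<zeta>) ^ p)"
    by (intro p_adv_freshman algebraic_int_times_complex algebraic_int_ieval) simp_all
  then have "of_nat p adv (of_int a + \<zeta> * ieval f \<zeta>) ^ p - (of_int a ^ p + (\<zeta> * ieval f \<zeta>) ^ p)
      + (ieval f \<zeta> ^ p - of_int n)"
    using n by (rule adv_add)
  also have "(of_int a + \<zeta> * ieval f \<zeta>) ^ p - (of_int a ^ p + (\<zeta> * ieval f \<zeta>) ^ p)
      + (ieval f \<zeta> ^ p - of_int n) = ieval (pCons a f) \<zeta> ^ p - of_int (a ^ p + n)"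
    by (simp add: power_mult_distrib)
  finally show ?case by blast
qed

text \<open>A polynomial of degree up to \<open>p - 1\<close> can be changed by a multiple of
  \<open>1 + X + ... + X^(p-1)\<close> without changing its value at \<zeta>. Removing the top
  coefficient this way reduces to the independent powers, so only differences of coefficients are
  controlled.\<close>

lemma coeffs_cong:
  assumes "Polynomial.degree f < p" "of_nat p adv ieval f \<zeta>" "i < p"
  shows "int p dvd poly.coeff f i - poly.coeff f (p - 1)"
proof -
  define \<Phi> :: "int poly" where "\<Phi> = (\<Sum>i<p. Polynomial.monom 1 i)"
  have \<Phi>: "poly.coeff \<Phi> i = (if i < p then 1 else 0)" for i
    by (simp add: \<Phi>_def coeff_sum)
  define g where "g = f - Polynomial.smult (poly.coeff f (p - 1)) \<Phi>"
  have "poly.coeff g i = 0" if "i \<ge> p - 1" for i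
    using that assms(1) by (cases "i = p - 1") (auto simp: g_def \<Phi> coeff_eq_0)
  then have "Polynomial.degree g < p - 1"
    using p_ge_3 by (intro degree_lessI) auto
  moreover have "ieval g \<zeta> = ieval f \<zeta>"
    using sum_root_powers[of \<zeta>] zeta_neq_1 by (simp add: g_def \<Phi>_def)
  ultimately have "[:int p:] dvd g" using assms(2) by (intro dvd_poly_if_p_adv) simp_all
  then have "int p dvd poly.coeff g i" unfolding const_poly_dvd_iff by blast
  then show ?thesis using \<open>i < p\<close> by (simp add: g_def \<Phi>)
qed

lemma adv_cnj: "of_nat p adv x \<Longrightarrow> of_nat p adv cnj x"
  unfolding adv_def by (metis algebraic_int_cnj complex_cnj_mult complex_cnj_of_nat)

subsection \<open>Coprime factors\<close>

definition comax :: "complex \<Rightarrow> complex \<Rightarrow> bool" where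
  "comax a b \<longleftrightarrow> (\<exists>s\<in>\<O>. \<exists>t\<in>\<O>. s * a + t * b = 1)"

lemma comax_commute: "comax a b \<longleftrightarrow> comax b a"
  unfolding comax_def by (metis add.commute)

lemma comax_mult:
  assumes "comax a b" "comax a c" "a \<in> \<O>" "b \<in> \<O>" "c \<in> \<O>"
  shows "comax a (b * c)"
proof -
  obtain s t s' t' where st: "s \<in> \<O>" "t \<in> \<O>" "s' \<in> \<O>" "t' \<in> \<O>" "s * a + t * b = 1" "s' * a + t' * c = 1"
    using assms unfolding comax_def by blast
  have "(s * (s' * a + t' * c) + t * b * s') * a + (t * t') * (b * c)
      = (s * a + t * b) * (s' * a + t' * c)" by (simp add: algebra_simps)
  then have "(s * (s' * a + t' * c) + t * b * s') * a + (t * t') * (b * c) = 1" using st(5,6) by simp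
  moreover have "s * (s' * a + t' * c) + t * b * s' \<in> \<O>" "t * t' \<in> \<O>"
    by (intro R_closed(4,6) st assms)+
  ultimately show ?thesis unfolding comax_def by blast
qed

lemma comax_one: "comax a 1"
  unfolding comax_def using R_closed(1,2) by (intro bexI[of _ 0] bexI[of _ 1]) simp_all

lemma prod_O: "(\<And>i. i \<in> I \<Longrightarrow> f i \<in> \<O>) \<Longrightarrow> prod f I \<in> \<O>"
  by (induction I rule: infinite_finite_induct) (simp_all add: R_closed(2,6))

lemma comax_prod:
  assumes "a \<in> \<O>" "\<And>i. i \<in> I \<Longrightarrow> f i \<in> \<O>" "\<And>i. i \<in> I \<Longrightarrow> comax a (f i)"
  shows "comax a (prod f I)"
  using assms(2,3)
  by (induction I rule: infinite_finite_induct) (simp_all add: comax_one comax_mult assms(1) prod_O)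

lemma comax_power:
  assumes "comax a b" "a \<in> \<O>" "b \<in> \<O>"
  shows "comax (a ^ n) b"
  using comax_prod[of b "{..<n}" "\<lambda>_. a"] assms by (simp add: comax_commute)

lemma zeta_power_O: "\<zeta> ^ k \<in> \<O>"
  using ieval_in_O[of "Polynomial.monom 1 k"] by simp

lemma linear_factor_O: "of_int x + \<zeta> ^ k * of_int y \<in> \<O>"
  by (intro R_closed(3,4,6) zeta_power_O)

lemma adv_quotient_O:
  assumes "d adv x" "d \<in> \<O>" "x \<in> \<O>" "d \<noteq> 0"
  obtains b where "b \<in> \<O>" "x = d * b"
proof -
  obtain b where b: "algebraic_int b" "x = d * b" using assms(1) unfolding adv_def by blast
  then have "b = inverse d * x" using assms(4) by simp
  also have "\<dots> \<in> cyclo_field" using assms(2,3) mem_O cyclo_field_inverse cyclo_field_closed(3) by blast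
  finally show thesis using that b mem_O by blast
qed

text \<open>The ideal \<open>J\<close> generated by both factors contains \<zeta> - \<zeta>^k times
  \<open>x\<close> and times \<open>y\<close>, hence \<zeta> - \<zeta>^k itself, which divides
  \<open>p\<close>. It also contains \<open>z^p\<close>, and \<open>p\<close> and \<open>z^p\<close>
  are coprime integers.\<close>

lemma comax_linear_factors:
  fixes x y z :: int
  assumes eq: "x ^ p + y ^ p = z ^ p" and cop: "Rings.coprime x y" and z: "\<not> int p dvd z"
    and k: "k < p" "k \<noteq> 1"
  shows "comax (of_int x + \<zeta> ^ 1 * of_int y) (of_int x + \<zeta> ^ k * of_int y)"
proof -
  define a c where "a = of_int x + \<zeta> ^ 1 * of_int y" and "c = of_int x + \<zeta> ^ k * of_int y"
  have ac: "a \<in> \<O>" "c \<in> \<O>" unfolding a_def c_def by (rule linear_factor_O)+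
  define J where "J = {s * a + t * c | s t. s \<in> \<O> \<and> t \<in> \<O>}"
  have J_add: "i + j \<in> J" if "i \<in> J" "j \<in> J" for i j
  proof -
    obtain s t s' t' where st: "s \<in> \<O>" "t \<in> \<O>" "s' \<in> \<O>" "t' \<in> \<O>" "i = s * a + t * c" "j = s' * a + t' * c"
      using \<open>i \<in> J\<close> \<open>j \<in> J\<close> unfolding J_def by blast
    have "i + j = (s + s') * a + (t + t') * c" by (simp add: st algebra_simps)
    then show ?thesis unfolding J_def using R_closed(4) st by blast
  qed
  have J_mult: "r * i \<in> J" if "r \<in> \<O>" "i \<in> J" for r i
  proof -
    obtain s t where st: "s \<in> \<O>" "t \<in> \<O>" "i = s * a + t * c"
      using \<open>i \<in> J\<close> unfolding J_def by blast
    have "r * i = (r * s) * a + (r * t) * c" by (simp add: st algebra_simps)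
    then show ?thesis unfolding J_def using R_closed(6) st \<open>r \<in> \<O>\<close> by blast
  qed
  have "1 * a + 0 * c \<in> J" "0 * a + 1 * c \<in> J"
    unfolding J_def using R_closed(1,2) by blast+
  then have aJ: "a \<in> J" and cJ: "c \<in> J" by simp_all
  define d where "d = \<zeta> - \<zeta> ^ k"
  have m1: "of_int (- 1) \<in> \<O>" by (rule R_closed(3))
  have "a + of_int (-1) * c \<in> J" by (intro J_add J_mult aJ cJ m1)
  then have dy: "d * of_int y \<in> J" by (simp add: a_def c_def d_def algebra_simps)
  have "\<zeta> ^ 1 * c + of_int (-1) * (\<zeta> ^ k * a) \<in> J" by (intro J_add J_mult aJ cJ m1 zeta_power_O)
  then have dx: "d * of_int x \<in> J" by (simp add: a_def c_def d_def algebra_simps)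
  obtain m n where mn: "m * x + n * y = 1" using bezout_int[of x y] cop by auto
  have "of_int m * (d * of_int x) + of_int n * (d * of_int y) \<in> J"
    by (intro J_add J_mult dx dy R_closed(3))
  also have "of_int m * (d * of_int x) + of_int n * (d * of_int y) = d * of_int (m * x + n * y)"
    by (simp add: algebra_simps)
  finally have dJ: "d \<in> J" by (simp add: mn)
  have dO: "d \<in> \<O>" using R_closed(5)[OF zeta_power_O[of 1] zeta_power_O[of k]] by (simp add: d_def)
  define j where "j = (k + (p - 1)) mod p"
  \<comment> \<open>The exponent \<open>k + (p - 1)\<close> stands for \<open>k - 1\<close> modulo
    \<open>p\<close>, since \<open>k\<close> may be 0. It lies strictly between 0 and
    \<open>2 p\<close> and equals \<open>p\<close> only for \<open>k = 1\<close>.\<close>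
  have nj: "\<not> p dvd k + (p - 1)"
  proof
    assume "p dvd k + (p - 1)"
    then obtain q where q: "k + (p - 1) = p * q" by blast
    have "0 < p * q" "p * q < p * 2" unfolding q[symmetric] using p_ge_3 k by auto
    then have "q = 1" by simp
    then show False using q k p_ge_3 by simp
  qed
  have "Suc (k + (p - 1)) = k + p" using p_ge_3 by simp
  then have "\<zeta> * \<zeta> ^ (k + (p - 1)) = \<zeta> ^ (k + p)" by (simp only: power_Suc[symmetric])
  also have "\<dots> = \<zeta> ^ k" by (simp add: power_add)
  finally have "\<zeta> * \<zeta> ^ (k + (p - 1)) = \<zeta> ^ k" .
  then have d: "d = (1 - \<zeta> ^ (k + (p - 1))) * \<zeta>" by (simp add: d_def algebra_simps)
  have "1 - \<zeta> ^ (k + (p - 1)) \<noteq> 0" using nj zeta_power_eq_1_iff by simp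
  then have d0: "d \<noteq> 0" unfolding d by simp
  have "d * \<zeta> ^ (p - 1) = 1 - \<zeta> ^ (k + (p - 1))"
    unfolding d using p_ge_3 by (simp add: mult.assoc flip: power_Suc)
  then have "d adv 1 - \<zeta> ^ (k + (p - 1))" using advI[of "\<zeta> ^ (p - 1)" d] by simp
  then have "d adv of_nat p"
    using one_minus_adv_lam[OF nj] lam_adv_p adv_trans by blast
  moreover have "of_int (int p) \<in> \<O>" by (rule R_closed(3))
  ultimately obtain b where b: "b \<in> \<O>" "of_nat p = d * b"
    using adv_quotient_O[of d "of_nat p"] dO d0 by auto
  have pJ: "of_nat p \<in> J" using J_mult[OF b(1) dJ] by (simp add: b(2) mult.commute)
  have "(\<Prod>i\<in>{..<p} - {1}. of_int x + \<zeta> ^ i * of_int y) * a = of_int x ^ p + of_int y ^ p"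
    unfolding prod_plus_zeta[symmetric] a_def
    using p_ge_3 by (subst (2) prod.remove[of _ 1]) (simp_all add: mult.commute)
  also have "\<dots> = of_int (z ^ p)" by (simp flip: eq)
  finally have zJ: "of_int (z ^ p) \<in> J"
    using J_mult[OF prod_O aJ, of "{..<p} - {1}" "\<lambda>i. of_int x + \<zeta> ^ i * of_int y"] linear_factor_O by simp
  have "Rings.coprime (int p) (z ^ p)"
    using prime_p z by (simp add: prime_imp_coprime)
  then obtain r s where rs: "r * int p + s * z ^ p = 1" using bezout_int[of "int p" "z ^ p"] by auto
  have "of_int r * of_nat p + of_int s * of_int (z ^ p) \<in> J"
    by (intro J_add J_mult pJ zJ R_closed(3))
  also have "of_int r * of_nat p + of_int s * of_int (z ^ p) = (of_int (r * int p + s * z ^ p) :: complex)"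
    by simp
  finally have "1 \<in> J" by (simp only: rs of_int_1)
  then show ?thesis unfolding J_def comax_def a_def c_def by (simp only: mem_Collect_eq) metis
qed

section \<open>From the factorization to congruences modulo \<open>p\<close>\<close>

lemma linear_factor_eq_unit_times_power:
  fixes x y z :: int
  assumes eq: "x ^ p + y ^ p = z ^ p" and cop: "Rings.coprime x y"
    and z: "\<not> int p dvd z" and h: "\<not> p dvd class_number (rat_adjoin \<zeta>) \<O>"
  obtains u g where "u \<in> \<O>" "inverse u \<in> \<O>" "u \<noteq> 0" "g \<in> \<O>" "of_int x + \<zeta> * of_int y = u * g ^ p"
proof -
  define a where "a = of_int x + \<zeta> ^ 1 * of_int y"
  define b where "b = (\<Prod>i\<in>{..<p} - {1}. of_int x + \<zeta> ^ i * of_int y)"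
  have aO: "a \<in> \<O>" unfolding a_def by (rule linear_factor_O)
  have bO: "b \<in> \<O>" unfolding b_def by (intro prod_O linear_factor_O)
  have "a * b = of_int x ^ p + of_int y ^ p"
    unfolding prod_plus_zeta[symmetric] a_def b_def
    using p_ge_3 by (subst (2) prod.remove[of _ 1]) simp_all
  also have "\<dots> = of_int z ^ p" by (simp flip: eq of_int_power of_int_add)
  finally have ab: "a * b = of_int z ^ p" .
  have "comax a b"
    unfolding b_def using comax_linear_factors[OF eq cop z] a_def
    by (intro comax_prod aO linear_factor_O) auto
  \<comment> \<open>The exponent is \<open>p - 1\<close> because the relation is next multiplied by
    \<open>a\<close>, giving the combination of \<open>a^p\<close> and \<open>a * b\<close> that
    \<open>coprime_factor_is_power\<close> expects.\<close>
  then have "comax (a ^ (p - 1)) b" by (rule comax_power[OF _ aO bO])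
  then obtain s t where st: "s \<in> \<O>" "t \<in> \<O>" "s * a ^ (p - 1) + t * b = 1" unfolding comax_def by blast
  have "a ^ p = a * a ^ (p - 1)" using p_ge_3 by (simp flip: power_Suc)
  then have "s * a ^ p + t * (a * b) = a * (s * a ^ (p - 1) + t * b)" by (simp add: algebra_simps)
  then have sab: "s * a ^ p + t * (a * b) = a" using st(3) by simp
  have "a \<noteq> 0"
  proof
    assume "a = 0"
    then have "z = 0" using ab p_ge_3 by (simp add: zero_power)
    then show False using z by simp
  qed
  moreover have "class_number (rat_adjoin \<zeta>) \<O> \<noteq> 0" using h by (intro notI) simp
  moreover have "Rings.coprime p (class_number (rat_adjoin \<zeta>) \<O>)"
    using prime_p h by (rule prime_imp_coprime)
  ultimately obtain u g where "u \<in> \<O>" "inverse u \<in> \<O>" "u \<noteq> 0" "g \<in> \<O>" "a = u * g ^ p"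
    using coprime_factor_is_power[OF _ _ p_pos aO bO R_closed(3) st(1,2) _ ab sab] by blast
  then show thesis using that by (simp add: a_def)
qed

text \<open>With \<open>g^p\<close> congruent to the integer \<open>n\<close>, the factor is
  congruent to \<open>u * n\<close>. Its conjugate is congruent to \<open>cnj u * n\<close>, because
  \<open>n\<close> is real, and \<open>cnj u\<close> differs from \<open>u\<close> only by a power
  of \<zeta>.\<close>

lemma p_adv_twisted_conjugate:
  fixes x y z :: int
  assumes "x ^ p + y ^ p = z ^ p" "Rings.coprime x y"
    and "\<not> int p dvd z" "\<not> p dvd class_number (rat_adjoin \<zeta>) \<O>"
  obtains k where "k < p"
    "of_nat p adv (of_int x + \<zeta> * of_int y) - \<zeta> ^ k * (of_int x + \<zeta> ^ (p - 1) * of_int y)"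
proof -
  obtain u g where u: "u \<in> \<O>" "inverse u \<in> \<O>" "u \<noteq> 0" and g: "g \<in> \<O>"
    and a: "of_int x + \<zeta> * of_int y = u * g ^ p"
    using linear_factor_eq_unit_times_power[OF assms] by blast
  obtain k where k: "k < p" "u = \<zeta> ^ k * cnj u"
    using unit_eq_root_of_unity_times_cnj[OF u] by blast
  obtain f where f: "g = ieval f \<zeta>" using O_cases[OF g] by blast
  obtain n where n: "of_nat p adv g ^ p - of_int n"
    using ieval_power_p_cong_int[of f] unfolding f by blast
  have alg: "algebraic_int u" "algebraic_int (cnj u)" using u(1) mem_O by auto
  have "of_nat p adv u * (g ^ p - of_int n)"
    by (rule adv_mult_left[OF n alg(1)])
  moreover have "of_nat p adv \<zeta> ^ k * (cnj u * cnj (g ^ p - of_int n))"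
    by (intro adv_mult_left adv_cnj n alg) simp
  ultimately have "of_nat p adv u * (g ^ p - of_int n) - \<zeta> ^ k * (cnj u * cnj (g ^ p - of_int n))"
    by (rule adv_diff)
  also have "u * (g ^ p - of_int n) - \<zeta> ^ k * (cnj u * cnj (g ^ p - of_int n))
      = u * g ^ p - \<zeta> ^ k * cnj (u * g ^ p) - (u - \<zeta> ^ k * cnj u) * of_int n"
    by (simp add: algebra_simps)
  also have "\<dots> = u * g ^ p - \<zeta> ^ k * cnj (u * g ^ p)" using k(2) by simp
  also have "cnj (u * g ^ p) = of_int x + \<zeta> ^ (p - 1) * of_int y"
    by (simp add: cnj_root_of_unity flip: a)
  finally show thesis using that k(1) unfolding a by blast
qed

lemma x_cong_y:
  fixes x y z :: int
  assumes p: "p \<ge> 5" and eq: "x ^ p + y ^ p = z ^ p" and cop: "Rings.coprime x y"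
    and xyz: "\<not> int p dvd x * y * z" and h: "\<not> p dvd class_number (rat_adjoin \<zeta>) \<O>"
  shows "int p dvd x - y"
proof -
  have nd: "\<not> int p dvd x" "\<not> int p dvd y" "\<not> int p dvd z" using xyz by (auto simp: dvd_mult dvd_mult2)
  obtain k where k: "k < p"
    "of_nat p adv (of_int x + \<zeta> * of_int y) - \<zeta> ^ k * (of_int x + \<zeta> ^ (p - 1) * of_int y)"
    using p_adv_twisted_conjugate[OF eq cop nd(3) h] by blast
  \<comment> \<open>The exponent of \<zeta>^k \<zeta>^(p-1), brought into the range below
    \<open>p\<close> so that \<open>f\<close> has degree less than \<open>p\<close>.\<close>
  define k' where "k' = (k + (p - 1)) mod p"
  have k'p: "k' < p" unfolding k'_def by simp
  have k'_simps: "k' = (if k = 0 then p - 1 else k - 1)"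
  proof (cases "k = 0")
    case False
    then have shift: "k + (p - 1) = (k - 1) + p" using p by simp
    show ?thesis unfolding k'_def shift mod_add_self2 using False k(1) by simp
  qed (use p in \<open>simp add: k'_def\<close>)
  define f where "f = Polynomial.monom x 0 + Polynomial.monom y 1 - Polynomial.monom x k - Polynomial.monom y k'"
  have coeff: "poly.coeff f i = (if i = 0 then x else 0) + (if i = 1 then y else 0)
      - (if i = k then x else 0) - (if i = k' then y else 0)" for i
    unfolding f_def by auto
  have "Polynomial.degree f < p"
    using k(1) k'p p by (intro degree_lessI) (auto simp: coeff)
  moreover have "ieval f \<zeta> = (of_int x + \<zeta> * of_int y) - \<zeta> ^ k * (of_int x + \<zeta> ^ (p - 1) * of_int y)"
    unfolding f_def k'_def by (simp add: zeta_power_mod power_add algebra_simps)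
  ultimately have cong: "int p dvd poly.coeff f i - poly.coeff f (p - 1)" if "i < p" for i
    using coeffs_cong[of f i] k(2) that by simp
  \<comment> \<open>As \<open>p >= 5\<close>, some exponent below \<open>p\<close> carries the
    coefficient 0; \<open>coeffs_cong\<close> then makes every coefficient divisible by
    \<open>p\<close>.\<close>
  have "card {0, 1, k, k'} \<le> 4" by (auto intro: order_trans[OF card_insert_le_m1] simp: card_insert_if)
  then have "\<not> {..<p} \<subseteq> {0, 1, k, k'}"
    using card_mono[of "{0, 1, k, k'}" "{..<p}"] p by auto
  then obtain i where i: "i < p" "i \<notin> {0, 1, k, k'}" by blast
  then have "poly.coeff f i = 0" unfolding coeff by auto
  then have last: "int p dvd poly.coeff f (p - 1)" using cong[OF i(1)] by simp
  have dvd: "int p dvd poly.coeff f i" if "i < p" for i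
    using dvd_add[OF cong[OF that] last] by simp
  \<comment> \<open>For \<open>k = 0\<close> the terms in \<open>x\<close> cancel and
    \<open>y\<close> remains alone at exponent 1; for \<open>k >= 2\<close> only \<open>x\<close>
    contributes at exponent 0. Both contradict that \<open>p\<close> divides neither. For
    \<open>k = 1\<close> exponent 0 carries \<open>x - y\<close>.\<close>
  consider "k = 0" | "k = 1" | "k \<ge> 2" by linarith
  then show ?thesis
  proof cases
    case 1
    then have "poly.coeff f 1 = y" using p by (simp add: coeff k'_simps)
    then show ?thesis using dvd[of 1] nd p by simp
  next
    case 2
    then have "poly.coeff f 0 = x - y" by (simp add: coeff k'_simps)
    then show ?thesis using dvd[of 0] p by simp
  next
    case 3
    then have "poly.coeff f 0 = x" by (simp add: coeff k'_simps)
    then show ?thesis using dvd[of 0] nd p by simp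
  qed
qed

lemma no_coprime_solution:
  fixes x y z :: int
  assumes p: "p \<ge> 5" and eq: "x ^ p + y ^ p = z ^ p" and cop: "Rings.coprime x y"
    and xyz: "\<not> int p dvd x * y * z" and h: "\<not> p dvd class_number (rat_adjoin \<zeta>) \<O>"
  shows False
proof -
  have prime: "prime (int p)" using prime_p by simp
  have 1: "int p dvd x - y" by (rule x_cong_y[OF p eq cop xyz h])
  have "Rings.coprime x (- z)"
  proof (rule coprimeI)
    fix c assume c: "c dvd x" "c dvd - z"
    have "c dvd z ^ p" "c dvd x ^ p"
      using c dvd_trans[OF _ dvd_power[of p]] by simp_all
    then have "c dvd z ^ p - x ^ p" by (rule dvd_diff)
    then have "c dvd y ^ p" by (simp flip: eq)
    moreover have "Rings.coprime x (y ^ p)" using cop by simp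
    ultimately show "is_unit c" using c(1) by (meson coprime_common_divisor)
  qed
  \<comment> \<open>For odd \<open>p\<close> the equation can be rearranged so that
    \<open>- z\<close> takes the place of \<open>y\<close>.\<close>
  moreover have "x ^ p + (- z) ^ p = (- y) ^ p" using odd_p eq by simp
  moreover have "\<not> int p dvd x * (- z) * (- y)" using xyz by (simp add: mult_ac)
  ultimately have 2: "int p dvd x - (- z)" using x_cong_y[OF p _ _ _ h] by blast
  have pow: "int p dvd a ^ p - b ^ p" if "int p dvd a - b" for a b :: int
    using that dvd_trans[OF _ dvd_triv_left] by (metis dvd_mult2 power_diff_sumr2)
  have "int p dvd x ^ p - y ^ p" "int p dvd x ^ p - (- z) ^ p" using pow[OF 1] pow[OF 2] .
  then have "int p dvd (x ^ p - y ^ p) + (x ^ p - (- z) ^ p)" by (rule dvd_add)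
  also have "(x ^ p - y ^ p) + (x ^ p - (- z) ^ p) = 3 * x ^ p" using odd_p by (simp flip: eq)
  finally have "int p dvd 3 \<or> int p dvd x ^ p" using prime_dvd_mult_iff[OF prime] by blast
  then show False
  proof
    assume "int p dvd 3"
    then show False using p zdvd_imp_le[of "int p" 3] by simp
  next
    assume "int p dvd x ^ p"
    then have "int p dvd x" by (rule prime_dvd_power[OF prime])
    then show False using xyz by simp
  qed
qed

end

section \<open>The exponent 3\<close>

lemma cube_mod_9:
  fixes x :: int
  assumes "\<not> 3 dvd x"
  shows "x ^ 3 mod 9 = 1 \<or> x ^ 3 mod 9 = 8"
proof -
  define q r where "q = x div 3" and "r = x mod 3"
  have x: "x = 3 * q + r" by (simp add: q_def r_def)
  have "x ^ 3 = r ^ 3 + 9 * (3 * q ^ 3 + 3 * q ^ 2 * r + q * r ^ 2)"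
    unfolding x by (simp add: power3_eq_cube power2_eq_square algebra_simps)
  then have "x ^ 3 mod 9 = r ^ 3 mod 9" by (simp only: mod_mult_self2)
  moreover have "r = 1 \<or> r = 2" using assms unfolding r_def by presburger
  ultimately show ?thesis by auto
qed

lemma no_cubic_solution:
  fixes x y z :: int
  assumes "\<not> 3 dvd x * y * z" "x ^ 3 + y ^ 3 = z ^ 3"
  shows False
proof -
  have "\<not> 3 dvd x" "\<not> 3 dvd y" "\<not> 3 dvd z" using assms(1) by (auto simp: dvd_mult dvd_mult2)
  then have "x ^ 3 mod 9 = 1 \<or> x ^ 3 mod 9 = 8" "y ^ 3 mod 9 = 1 \<or> y ^ 3 mod 9 = 8"
    "(x ^ 3 + y ^ 3) mod 9 = 1 \<or> (x ^ 3 + y ^ 3) mod 9 = 8"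
    unfolding assms(2) using cube_mod_9 by blast+
  \<comment> \<open>A sum of two residues from 1 and -1 modulo 9 is 0, 2 or -2, never 1 or
    -1.\<close>
  then show False by presburger
qed

theorem mainTheorem2:
  fixes p h :: nat and \<zeta> :: complex and K :: "complex ring"
  assumes "prime p" and "odd p"
    and "\<zeta> = exp (2 * of_real pi * \<i> / of_nat p)"
    and "K = rat_adjoin \<zeta>"
    and "h = class_number K (ring_of_integers K)"
    and "\<not> p dvd h"
  shows "\<not> (\<exists>x\<^sub>0 y\<^sub>0 z\<^sub>0 :: int.
            \<not> int p dvd x\<^sub>0 * y\<^sub>0 * z\<^sub>0 \<and> x\<^sub>0 ^ p + y\<^sub>0 ^ p = z\<^sub>0 ^ p)"
proof
  assume "\<exists>x\<^sub>0 y\<^sub>0 z\<^sub>0 :: int. \<not> int p dvd x\<^sub>0 * y\<^sub>0 * z\<^sub>0 \<and> x\<^sub>0 ^ p + y\<^sub>0 ^ p = z\<^sub>0 ^ p"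
  then obtain x y z :: int where xyz: "\<not> int p dvd x * y * z" and eq: "x ^ p + y ^ p = z ^ p"
    by blast
  interpret prime_cyclotomic p \<zeta> by unfold_locales (fact assms)+
  show False
  proof (cases "p = 3")
    case True
    then show False using no_cubic_solution xyz eq by simp
  next
    case False
    have "p \<noteq> 4" using assms(2) by auto
    then have p: "p \<ge> 5" using p_ge_3 False by linarith
    have "x \<noteq> 0" using xyz by auto
    \<comment> \<open>The comaximality of the linear factors needs coprime \<open>x\<close> and
      \<open>y\<close>, so the common factor is divided out. It also divides \<open>z\<close>,
      because its \<open>p\<close>-th power divides \<open>z^p\<close>.\<close>
    define g where "g = gcd x y"
    have g: "g \<noteq> 0" using \<open>x \<noteq> 0\<close> by (simp add: g_def)
    obtain x' y' where x': "x = g * x'" and y': "y = g * y'"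
      using gcd_dvd1[of x y] gcd_dvd2[of x y] unfolding g_def by (elim dvdE)
    have "Rings.coprime x' y'"
    proof -
      have "\<bar>g\<bar> * gcd x' y' = gcd x y" unfolding x' y' by (rule gcd_mult_distrib_int)
      also have "\<dots> = \<bar>g\<bar> * 1" by (simp add: g_def)
      finally show ?thesis using g by (simp add: coprime_iff_gcd_eq_1)
    qed
    have "z ^ p = g ^ p * (x' ^ p + y' ^ p)"
      by (simp add: x' y' power_mult_distrib distrib_left flip: eq)
    then have "g ^ p dvd z ^ p" by simp
    then have "g dvd z" using p_pos by (simp add: pow_divides_pow_iff)
    then obtain z' where z': "z = g * z'" by blast
    have "g ^ p * (x' ^ p + y' ^ p) = g ^ p * z' ^ p"
      using eq by (simp add: x' y' z' power_mult_distrib distrib_left)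
    then have "x' ^ p + y' ^ p = z' ^ p" using g by simp
    moreover have "\<not> int p dvd x' * y' * z'"
    proof
      assume "int p dvd x' * y' * z'"
      then have "int p dvd (x' * y' * z') * g ^ 3" by simp
      also have "(x' * y' * z') * g ^ 3 = x * y * z" by (simp add: x' y' z' power3_eq_cube)
      finally show False using xyz by simp
    qed
    ultimately show False
      using no_coprime_solution[OF p] \<open>Rings.coprime x' y'\<close> assms(4-6) by blast
  qed
qed

end
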